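(* Let $r \geq 1$ and $n \geq r+2$ be integers, and let $G(p)$ be a bar framework on $n$ vertices in $\mathbb{R}^r$ such that the graph $G$ is chordal and the configuration $p=(p^1,\ldots,p^n)$ is in general position in $\mathbb{R}^r$. Then the following statements are equivalent: (1) $G$ is $(r+1)$-vertex connected. (2) $G(p)$ admits a positive semidefinite stress matrix $S$ of rank $n-r-1$. (3) $G(p)$ is universally rigid. (4) $G(p)$ is globally rigid.
   Context: A bar framework $G(p)$ in $\mathbb{R}^r$ on $n$ vertices is a connected simple graph $G$ with vertex set $\{1,\ldots,n\}$ and edge set $E(G)$, together with a configuration $p=(p^1,\ldots,p^n)$ of points in $\mathbb{R}^r$ that affinely span $\mathbb{R}^r$ (vertex $i$ is placed at $p^i$). General position: $p$ is in general position in $\mathbb{R}^r$ if every $r+1$ of the points $p^1,\ldots,p^n$ are affinely independent. Chordal: $G$ is chordal if every cycle of $G$ of length at least $4$ has a chord, i.e. an edge joining two non-consecutive vertices of the cycle. Vertex connectivity: $G$ is $k$-vertex connected if and only if either $G$ is the complete graph on $k+1$ vertices, or $|V(G)|\geq k+2$ and the deletion of any $k-1$ vertices leaves $G$ connected. Equivalence and congruence: frameworks $G(p)$ in $\mathbb{R}^r$ and $G(q)$ in $\mathbb{R}^s$ (with the same graph $G$) are equivalent if $\|q^i-q^j\|=\|p^i-p^j\|$ for all $(i,j)\in E(G)$; they are congruent if $\|q^i-q^j\|=\|p^i-p^j\|$ for all $i,j=1,\ldots,n$. Here $\|\cdot\|$ is the Euclidean norm. $G(p)$ in $\mathbb{R}^r$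 is globally rigid if every framework $G(q)$ in the same dimension $\mathbb{R}^r$ that is equivalent to $G(p)$ is congruent to $G(p)$. It is universally rigid if every framework $G(q)$ in any dimension that is equivalent to $G(p)$ is congruent to $G(p)$. Stress matrix: an equilibrium stress of $G(p)$ is a real-valued function $\omega$ on $E(G)$ (with $\omega_{ij}=\omega_{ji}$) such that $\sum_{j:(i,j)\in E(G)}\omega_{ij}(p^i-p^j)=0$ for all $i=1,\ldots,n$. The associated stress matrix is the $n\times n$ symmetric matrix $S=(s_{ij})$ with $s_{ij}=-\omega_{ij}$ if $(i,j)\in E(G)$, $s_{ij}=0$ if $i\neq j$ and $(i,j)\notin E(G)$, and $s_{ii}=\sum_{k:(i,k)\in E(G)}\omega_{ik}$. *)

theory Defs
  imports Complex_Main "Graph_Theory.Graph_Theory" "Jordan_Normal_Form.DL_Rank"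
begin

text \<open>
  Conventions. The vertices \<open>1, \<dots>, n\<close> are numbered \<open>0, \<dots>, n - 1\<close>, to agree with the indexing
  of vectors and matrices. A simple graph is a loop-free symmetric digraph (\<open>pair_graph\<close>); an
  undirected edge \<open>ij\<close> is the pair of arcs \<open>(i, j)\<close>, \<open>(j, i)\<close>. A configuration in \<open>\<real>\<^sup>r\<close> is a function
  into \<open>carrier_vec r\<close>, of which only the values at \<open>0, \<dots>, n - 1\<close> matter; since the dimension is a
  term and not a type, it can be quantified over in the definition of universal rigidity.
\<close>

section \<open>Graphs\<close>

text \<open>
  A cycle of the library is a list of arcs. For length at least 4 these are exactly the
  (oriented, rooted) cycles of the undirected graph: the degenerate closed walk \<open>u, v, u\<close> has
  length 2. Its vertices are the tails of its arcs, and two of them are consecutive iff an arc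
  of the cycle joins them.
\<close>
definition chordal :: "'a pair_pre_digraph \<Rightarrow> bool" where
  "chordal G \<longleftrightarrow>
    (\<forall>c. pre_digraph.cycle (with_proj G) c \<and> length c \<ge> 4 \<longrightarrow>
      (\<exists>u \<in> fst ` set c. \<exists>v \<in> fst ` set c.
         (u, v) \<in> parcs G \<and> (u, v) \<notin> set c \<and> (v, u) \<notin> set c))"

text \<open>Intended for \<open>k \<ge> 1\<close>.\<close>
definition vertex_connected :: "nat \<Rightarrow> 'a pair_pre_digraph \<Rightarrow> bool" where
  "vertex_connected k G \<longleftrightarrow>
    complete_digraph (k + 1) (with_proj G) \<or>
    card (pverts G) \<ge> k + 2 \<and>
    (\<forall>X. X \<subseteq> pverts G \<and> card X = k - 1 \<longrightarrow>
      Digraph_Component.connected (induce_subgraph (with_proj G) (pverts G - X)))"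

section \<open>Configurations\<close>

definition edist :: "real vec \<Rightarrow> real vec \<Rightarrow> real" where
  "edist x y = sqrt ((x - y) \<bullet> (x - y))"

definition affinely_spans :: "nat \<Rightarrow> nat \<Rightarrow> (nat \<Rightarrow> real vec) \<Rightarrow> bool" where
  "affinely_spans n r p \<longleftrightarrow>
    (\<forall>x \<in> carrier_vec r. \<exists>c. (\<Sum>i<n. c i) = 1 \<and>
      finsum_vec TYPE(real) r (\<lambda>i. c i \<cdot>\<^sub>v p i) {..<n} = x)"

text \<open>Affine independence of an indexed family; in particular, its members are distinct.\<close>
definition affinely_independent :: "nat \<Rightarrow> nat set \<Rightarrow> (nat \<Rightarrow> real vec) \<Rightarrow> bool" where
  "affinely_independent r I p \<longleftrightarrow>
    (\<forall>c. (\<Sum>i\<in>I. c i) = 0 \<and> finsum_vec TYPE(real) r (\<lambda>i. c i \<cdot>\<^sub>v p i) I = 0\<^sub>v r \<longrightarrow>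
      (\<forall>i\<in>I. c i = 0))"

definition general_position :: "nat \<Rightarrow> nat \<Rightarrow> (nat \<Rightarrow> real vec) \<Rightarrow> bool" where
  "general_position n r p \<longleftrightarrow>
    (\<forall>I. I \<subseteq> {..<n} \<and> card I = r + 1 \<longrightarrow> affinely_independent r I p)"

section \<open>Frameworks and rigidity\<close>

definition bar_framework ::
  "nat \<Rightarrow> nat \<Rightarrow> nat pair_pre_digraph \<Rightarrow> (nat \<Rightarrow> real vec) \<Rightarrow> bool" where
  "bar_framework n r G p \<longleftrightarrow>
    pair_graph G \<and> pverts G = {..<n} \<and> Digraph_Component.connected (with_proj G) \<and>
    (\<forall>i<n. p i \<in> carrier_vec r) \<and> affinely_spans n r p"

definition equivalent ::
  "nat pair_pre_digraph \<Rightarrow> (nat \<Rightarrow> real vec) \<Rightarrow> (nat \<Rightarrow> real vec) \<Rightarrow> bool" where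
  "equivalent G p q \<longleftrightarrow> (\<forall>(i, j) \<in> parcs G. edist (q i) (q j) = edist (p i) (p j))"

definition congruent :: "nat \<Rightarrow> (nat \<Rightarrow> real vec) \<Rightarrow> (nat \<Rightarrow> real vec) \<Rightarrow> bool" where
  "congruent n p q \<longleftrightarrow> (\<forall>i<n. \<forall>j<n. edist (q i) (q j) = edist (p i) (p j))"

definition globally_rigid ::
  "nat \<Rightarrow> nat \<Rightarrow> nat pair_pre_digraph \<Rightarrow> (nat \<Rightarrow> real vec) \<Rightarrow> bool" where
  "globally_rigid n r G p \<longleftrightarrow>
    (\<forall>q. bar_framework n r G q \<and> equivalent G p q \<longrightarrow> congruent n p q)"

definition universally_rigid ::
  "nat \<Rightarrow> nat pair_pre_digraph \<Rightarrow> (nat \<Rightarrow> real vec) \<Rightarrow> bool" where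
  "universally_rigid n G p \<longleftrightarrow>
    (\<forall>s q. bar_framework n s G q \<and> equivalent G p q \<longrightarrow> congruent n p q)"

section \<open>Stresses\<close>

text \<open>Only the values of \<open>\<omega>\<close> on the edges matter.\<close>
definition equilibrium_stress ::
  "nat \<Rightarrow> nat \<Rightarrow> nat pair_pre_digraph \<Rightarrow> (nat \<Rightarrow> real vec) \<Rightarrow> (nat \<Rightarrow> nat \<Rightarrow> real) \<Rightarrow> bool" where
  "equilibrium_stress n r G p \<omega> \<longleftrightarrow>
    (\<forall>(i, j) \<in> parcs G. \<omega> i j = \<omega> j i) \<and>
    (\<forall>i<n. finsum_vec TYPE(real) r (\<lambda>j. \<omega> i j \<cdot>\<^sub>v (p i - p j)) {j. (i, j) \<in> parcs G} = 0\<^sub>v r)"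

definition stress_matrix_of ::
  "nat \<Rightarrow> nat pair_pre_digraph \<Rightarrow> (nat \<Rightarrow> nat \<Rightarrow> real) \<Rightarrow> real mat" where
  "stress_matrix_of n G \<omega> = mat n n (\<lambda>(i, j).
    if i = j then (\<Sum>k | (i, k) \<in> parcs G. \<omega> i k)
    else if (i, j) \<in> parcs G then - \<omega> i j
    else 0)"

definition stress_matrix ::
  "nat \<Rightarrow> nat \<Rightarrow> nat pair_pre_digraph \<Rightarrow> (nat \<Rightarrow> real vec) \<Rightarrow> real mat \<Rightarrow> bool" where
  "stress_matrix n r G p S \<longleftrightarrow>
    (\<exists>\<omega>. equilibrium_stress n r G p \<omega> \<and> S = stress_matrix_of n G \<omega>)"

definition positive_semidefinite :: "nat \<Rightarrow> real mat \<Rightarrow> bool" where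
  "positive_semidefinite n S \<longleftrightarrow>
    S \<in> carrier_mat n n \<and> transpose_mat S = S \<and> (\<forall>x \<in> carrier_vec n. x \<bullet> (S *\<^sub>v x) \<ge> 0)"

end

theory Submission
  imports Defs
begin

text \<open>
  The implications are (1) \<open>\<Longrightarrow>\<close> (2), (1) and (2) \<open>\<Longrightarrow>\<close> (3), (3) \<open>\<Longrightarrow>\<close> (4), (4) \<open>\<Longrightarrow>\<close> (1)
  and (2) \<open>\<Longrightarrow>\<close> (1). Only (3) \<open>\<Longrightarrow>\<close> (4) is immediate. Throughout,
  \<open>(r + 1)\<close>-vertex connectivity is used in the form that no \<open>r\<close> vertices separate the graph
  (\<open>separation_free\<close>), which treats the complete graph and the larger graphs alike.

  Failure of (1) destroys both (4) and (2). If \<open>r\<close> vertices \<open>X\<close> separate \<open>A\<close> from \<open>B\<close>,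
  general position puts them in a hyperplane that contains no other point of the
  configuration. Reflecting the points of \<open>B\<close> in it preserves all edge lengths
  but changes the distance between \<open>A\<close> and \<open>B\<close> (\<open>not_separation_free_imp_flip\<close>), so the
  framework is not globally rigid. A positive semidefinite stress matrix \<open>S\<close>
  measures an energy that depends on the edge lengths only. Hence \<open>S\<close> annihilates the
  coordinates of every equivalent configuration (\<open>equivalent_in_kernel_of_psd_stress\<close>). At rank
  \<open>n - r - 1\<close> a kernel vector is determined by its values at any \<open>r + 1\<close> vertices
  (\<open>stress_rank_iff\<close>), and the reflected configuration agrees with \<open>p\<close> at the \<open>r + 1\<close> vertices
  \<open>X \<union> {a}\<close>, \<open>a \<in> A\<close>; so the reflection would have to be trivial.

  For the converse, a chordal graph has a simplicial vertex
  (\<open>chordal_has_simplicial_vertex\<close>). If no \<open>r\<close> vertices separate the graph, this vertex has at least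
  \<open>r + 1\<close> neighbours, and its removal preserves the hypothesis (\<open>chordal_peel_vertex\<close>).
  Peeling off such vertices one by one leaves \<open>r + 1\<close> vertices, and each peeled vertex spans with
  \<open>r + 1\<close> of its remaining neighbours a clique of \<open>r + 2\<close> vertices. The affine dependency
  \<open>a\<close> of the points of that clique gives the positive semidefinite stress matrix
  \<open>a a\<^sup>T\<close>, and the sum of these \<open>n - r - 1\<close> matrices has the required
  rank (\<open>chordal_imp_super_stable\<close>), which is (2).

  Finally, for (3), let \<open>q\<close> be equivalent to \<open>p\<close>. The rank condition makes each
  \<open>q\<^sub>j\<close> the affine combination of the \<open>q\<^sub>i\<close>, \<open>i \<in> K\<close>, with the barycentric coordinates
  of \<open>p\<^sub>j\<close> as coefficients, for any set \<open>K\<close> of \<open>r + 1\<close> vertices. When \<open>K\<close> is a clique, the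
  distances inside \<open>K\<close> are edge lengths, and they determine all the others
  (\<open>universally_rigid_if_psd_stress_and_clique\<close>).
\<close>

section \<open>Simplicial vertices of chordal graphs\<close>

definition clique :: "'a rel \<Rightarrow> 'a set \<Rightarrow> bool" where
  "clique E K \<longleftrightarrow> (\<forall>x\<in>K. \<forall>y\<in>K. x \<noteq> y \<longrightarrow> (x, y) \<in> E)"

definition simplicial :: "'a rel \<Rightarrow> 'a set \<Rightarrow> 'a \<Rightarrow> bool" where
  "simplicial E W v \<longleftrightarrow> v \<in> W \<and> clique E (E `` {v} \<inter> W)"

text \<open>
  A closed walk is handled below as a function \<open>g\<close> on \<open>{0..N}\<close>. This lemma and the next one
  translate it into the list of arcs that the definition of a cycle speaks of.
\<close>
lemma pcas_map_upt:
  "pcas (g a) (map (\<lambda>i. (g i, g (Suc i))) [a..<a + m]) (g (a + m))"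
proof (induction m arbitrary: a)
  case (Suc m)
  show ?case using Suc[of "Suc a"] by (simp add: upt_conv_Cons del: upt_Suc)
qed simp

lemma pawalk_verts_map_upt:
  "pawalk_verts (g a) (map (\<lambda>i. (g i, g (Suc i))) [a..<a + m]) = map g [a..<Suc (a + m)]"
proof (induction m arbitrary: a)
  case (Suc m)
  show ?case using Suc[of "Suc a"] by (simp add: upt_conv_Cons del: upt_Suc)
qed simp

text \<open>
  Chordality for cycles that are given by their sequence of vertices. Distinctness is required
  of the vertices \<open>g 0, \<dots>, g (N - 1)\<close>, while the definition of a cycle omits the first
  vertex instead of the last.
\<close>
lemma chordal_closed_walk_chord:
  assumes "pair_wf_digraph G" "chordal G" and N: "N \<ge> 4"
    and inj: "inj_on g {..<N}" and closed: "g N = g 0"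
    and edges: "\<And>i. i < N \<Longrightarrow> (g i, g (Suc i)) \<in> parcs G"
  obtains i j where "i < N" "j < N" "(g i, g j) \<in> parcs G" "g j \<noteq> g (Suc i)" "g i \<noteq> g (Suc j)"
proof -
  interpret pair_wf_digraph G by fact
  define c where "c = map (\<lambda>i. (g i, g (Suc i))) [0..<N]"
  have c: "set c = (\<lambda>i. (g i, g (Suc i))) ` {..<N}" by (auto simp: c_def)
  have verts: "pawalk_verts (g 0) c = map g [0..<Suc N]"
    using pawalk_verts_map_upt[of g 0 N] by (simp add: c_def)
  have "inj_on g {1..<Suc N}"
  proof (rule inj_onI)
    fix i j assume ij: "i \<in> {1..<Suc N}" "j \<in> {1..<Suc N}" "g i = g j"
    \<comment> \<open>The index \<open>N\<close> stands for the same vertex as \<open>0\<close>.\<close>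
    define red where "red k = (if k = N then 0 else k)" for k
    have red: "g (red k) = g k" for k using closed by (simp add: red_def)
    have "red i \<in> {..<N}" "red j \<in> {..<N}" using ij N by (auto simp: red_def)
    with inj_onD[OF inj] ij(3) have "red i = red j" by (simp add: red)
    then show "i = j" using ij by (auto simp: red_def split: if_splits)
  qed
  then have "distinct (tl (pawalk_verts (g 0) c))"
    unfolding verts by (simp add: upt_conv_Cons distinct_map del: upt_Suc)
  moreover have "pcas (g 0) c (g 0)" using pcas_map_upt[of g 0 N] closed by (simp add: c_def)
  moreover have "g 0 \<in> pverts G" using edges[of 0] N by (auto intro: in_arcsD1)
  moreover have "set c \<subseteq> parcs G" using edges by (auto simp: c)
  ultimately have "cycle c" using N by (auto simp: cycle_def awalk_def c_def)
  moreover have "length c \<ge> 4" using N by (simp add: c_def)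
  ultimately obtain u v where uv: "u \<in> fst ` set c" "v \<in> fst ` set c"
      "(u, v) \<in> parcs G" "(u, v) \<notin> set c" "(v, u) \<notin> set c"
    using \<open>chordal G\<close> unfolding chordal_def by blast
  then obtain i j where "i < N" "u = g i" "j < N" "v = g j" by (auto simp: c)
  with uv that[of i j] show ?thesis by (auto simp: c)
qed

text \<open>
  A path of minimal length repeats no vertex and has no shortcuts, because cutting out the part
  between two equal or adjacent vertices would shorten it.
\<close>
lemma shortest_path:
  assumes "(x, y) \<in> R\<^sup>*"
  obtains f :: "nat \<Rightarrow> 'a" and m where "f 0 = x" "f m = y"
    "\<And>i. i < m \<Longrightarrow> (f i, f (Suc i)) \<in> R" "inj_on f {..m}"
    "\<And>i j. i \<le> m \<Longrightarrow> j \<le> m \<Longrightarrow> (f i, f j) \<in> R \<Longrightarrow> j \<le> Suc i"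
proof -
  define m where "m = (LEAST m. (x, y) \<in> R ^^ m)"
  from assms obtain k where "(x, y) \<in> R ^^ k" by (auto simp: rtrancl_power)
  then have "(x, y) \<in> R ^^ m" unfolding m_def by (rule LeastI)
  then obtain f where f: "f 0 = x" "f m = y" "\<And>i. i < m \<Longrightarrow> (f i, f (Suc i)) \<in> R"
    by (auto simp: relpow_fun_conv)
  have minimal: "m \<le> k" if "(x, y) \<in> R ^^ k" for k using that unfolding m_def by (rule Least_le)
  have sub: "(f i, f j) \<in> R ^^ (j - i)" if "i \<le> j" "j \<le> m" for i j
    using that f(3) by (auto simp: relpow_fun_conv intro!: exI[of _ "\<lambda>k. f (i + k)"])
  have shortcut: "j \<le> i + l" if "(f i, f j) \<in> R ^^ l" "i \<le> m" "j \<le> m" for i j l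
  proof -
    have "(x, f i) \<in> R ^^ i" "(f j, y) \<in> R ^^ (m - j)"
      using sub[of 0 i] sub[of j m] that f(1,2) by auto
    with that(1) have "(x, y) \<in> R ^^ (i + (l + (m - j)))"
      unfolding relpow_add by blast
    from minimal[OF this] show ?thesis using \<open>j \<le> m\<close> by simp
  qed
  have "inj_on f {..m}"
  proof (rule inj_onI)
    fix i j assume "i \<in> {..m}" "j \<in> {..m}" "f i = f j"
    then show "i = j" using shortcut[of i j 0] shortcut[of j i 0] by simp
  qed
  moreover have "j \<le> Suc i" if "i \<le> m" "j \<le> m" "(f i, f j) \<in> R" for i j
    using shortcut[of i j 1] that by simp
  ultimately show ?thesis using that[of f m] f by blast
qed

text \<open>
  A shortest path from \<open>x\<close> to \<open>y\<close> through \<open>A\<close> closes up at \<open>b\<close> to a cycle. If \<open>x\<close> and \<open>y\<close>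
  are not adjacent, it has length at least 4. No chord joins two vertices of the path, which is
  shortest, and none ends in \<open>b\<close>, whose only neighbours on the path are \<open>x\<close> and \<open>y\<close>.
\<close>
lemma chordal_common_nbrs_adjacent:
  assumes "pair_graph G" "chordal G"
    and conn: "(x, y) \<in> (parcs G \<inter> (A \<union> {x, y}) \<times> (A \<union> {x, y}))\<^sup>*"
    and b: "(b, x) \<in> parcs G" "(b, y) \<in> parcs G" and far: "\<And>a. a \<in> A \<Longrightarrow> (b, a) \<notin> parcs G"
    and "b \<notin> A" "x \<noteq> y"
  shows "(x, y) \<in> parcs G"
proof (rule ccontr)
  assume nadj: "(x, y) \<notin> parcs G"
  interpret pair_graph G by fact
  define W where "W = A \<union> {x, y}"
  let ?R = "parcs G \<inter> W \<times> W"
  have sym: "(v, u) \<in> parcs G" if "(u, v) \<in> parcs G" for u v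
    using that by (rule arcs_symmetric)
  have loop: "(u, u) \<notin> parcs G" for u using pair_no_loops[of "(u, u)"] by auto
  obtain f m where f: "f 0 = x" "f m = y" "\<And>i. i < m \<Longrightarrow> (f i, f (Suc i)) \<in> ?R" "inj_on f {..m}"
    "\<And>i j. i \<le> m \<Longrightarrow> j \<le> m \<Longrightarrow> (f i, f j) \<in> ?R \<Longrightarrow> j \<le> Suc i"
    using shortest_path[OF conn[folded W_def]] by metis
  have "m \<noteq> 0" using f(1,2) \<open>x \<noteq> y\<close> by metis
  moreover have "m \<noteq> 1" using f(1,2) f(3)[of 0] nadj by auto
  ultimately have m: "m \<ge> 2" by auto
  have mem: "f i \<in> W" if "i \<le> m" for i
    using f(3)[of i] f(2) that by (cases "i = m") (auto simp: W_def)
  have bf: "f i \<noteq> b" if "i \<le> m" for i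
    using mem[OF that] \<open>b \<notin> A\<close> b loop by (auto simp: W_def)
  \<comment> \<open>Along the path from \<open>x\<close> to \<open>y\<close>, then through \<open>b\<close> back to \<open>x\<close>.\<close>
  define g where "g k = (if k \<le> m then f k else if k = Suc m then b else f 0)" for k
  obtain i j where ij: "i < m + 2" "j < m + 2" "(g i, g j) \<in> parcs G"
      "g j \<noteq> g (Suc i)" "g i \<noteq> g (Suc j)"
  proof (rule chordal_closed_walk_chord[of G "m + 2" g])
    show "pair_wf_digraph G" by unfold_locales
    show "chordal G" by fact
    show "m + 2 \<ge> 4" using m by simp
    show "inj_on g {..<m + 2}"
      using f(4) bf by (auto simp: inj_on_def g_def)
    show "g (m + 2) = g 0" by (simp add: g_def)
    fix i assume "i < m + 2"
    then consider "i < m" | "i = m" | "i = Suc m" by linarith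
    then show "(g i, g (Suc i)) \<in> parcs G"
      using f(1-3) b sym[OF b(1)] sym[OF b(2)] by cases (auto simp: g_def)
  qed auto
  have path: "j = Suc i \<or> i = Suc j \<or> i = j" if "i \<le> m" "j \<le> m" "(f i, f j) \<in> parcs G" for i j
  proof -
    have "(f i, f j) \<in> ?R" "(f j, f i) \<in> ?R" using that(3) sym[OF that(3)] mem[OF that(1)] mem[OF that(2)]
      by simp_all
    then show ?thesis using f(5)[of i j] f(5)[of j i] that by auto
  qed
  have apex: "k = 0 \<or> k = m" if "k \<le> m" "(b, f k) \<in> parcs G" for k
  proof -
    have "f k = x \<or> f k = y" using mem[OF that(1)] far that(2) by (auto simp: W_def)
    then show ?thesis using f(1,2,4) that(1) by (auto dest: inj_onD)
  qed
  show False
  proof (cases "i \<le> m \<and> j \<le> m")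
    case True
    then have "j = Suc i \<or> i = Suc j \<or> i = j" using path ij(3) by (simp add: g_def)
    then show False using ij loop by auto
  next
    case False
    then consider "i = Suc m" "j = Suc m" | "i = Suc m" "j \<le> m" | "j = Suc m" "i \<le> m"
      using ij(1,2) by linarith
    then show False
    proof cases
      case 1 then show False using ij(3) loop by simp
    next
      case 2
      then have "j = 0 \<or> j = m" using apex[of j] ij(3) by (simp add: g_def)
      then show False using ij 2 by (auto simp: g_def)
    next
      case 3
      then have "i = 0 \<or> i = m" using apex[of i] sym[OF ij(3)] by (simp add: g_def)
      then show False using ij 3 by (auto simp: g_def)
    qed
  qed
qed

text \<open>
  Dirac's theorem, by induction on the number of vertices. In a graph that is not complete,
  take a maximal connected set \<open>A\<close> that is not dominating, i.e. the set \<open>far A\<close> of vertices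
  outside \<open>A\<close> without neighbours in \<open>A\<close> is nonempty. Let \<open>N\<close> be the set of the remaining
  vertices, which are the neighbours of \<open>A\<close>. Every \<open>x \<in> N\<close> is adjacent to all of \<open>far A\<close>, since
  otherwise \<open>A \<union> {x}\<close> would be a larger such set; and then \<open>N\<close> is a clique by
  \<open>chordal_common_nbrs_adjacent\<close>. So a vertex that is simplicial in \<open>far A\<close> is simplicial in the whole graph: its
  neighbourhood grows by \<open>N\<close>, a clique joined completely to \<open>far A\<close>.
\<close>
lemma chordal_has_simplicial_vertex:
  assumes G: "pair_graph G" "chordal G" and "finite W" "W \<noteq> {}"
  shows "\<exists>v. simplicial (parcs G) W v"
  using \<open>finite W\<close> \<open>W \<noteq> {}\<close>
proof (induction "card W" arbitrary: W rule: less_induct)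
  case less
  interpret pair_graph G by fact
  let ?E = "parcs G"
  have sym: "(v, u) \<in> ?E" if "(u, v) \<in> ?E" for u v
    using that by (rule arcs_symmetric)
  define conn where "conn A \<longleftrightarrow> (\<forall>u\<in>A. \<forall>v\<in>A. (u, v) \<in> (?E \<inter> A \<times> A)\<^sup>*)" for A
  define far where "far A = {b \<in> W - A. \<forall>a\<in>A. (b, a) \<notin> ?E}" for A
  define \<A> where "\<A> = {A. A \<subseteq> W \<and> A \<noteq> {} \<and> conn A \<and> far A \<noteq> {}}"
  show ?case
  proof (cases "\<A> = {}")
    case True
    obtain w where w: "w \<in> W" using less.prems by auto
    have "(u, v) \<in> ?E" if "u \<in> W" "v \<in> W" "u \<noteq> v" for u v
    proof (rule ccontr)
      assume "(u, v) \<notin> ?E"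
      then have "{v} \<in> \<A>" using that by (auto simp: \<A>_def conn_def far_def)
      with True show False by simp
    qed
    with w have "simplicial ?E W w" by (auto simp: simplicial_def clique_def)
    then show ?thesis ..
  next
    case False
    have "finite \<A>" using less.prems by (auto simp: \<A>_def intro: finite_subset[of _ "Pow W"])
    from finite_has_maximal[OF this False] obtain A where
      A: "A \<subseteq> W" "A \<noteq> {}" "conn A" "far A \<noteq> {}" and max: "\<And>B. B \<in> \<A> \<Longrightarrow> A \<subseteq> B \<Longrightarrow> A = B"
      by (auto simp: \<A>_def)
    let ?B = "far A"
    define N where "N = W - A - ?B"
    have N: "\<exists>a\<in>A. (x, a) \<in> ?E" if "x \<in> N" for x
      using that by (auto simp: N_def far_def)
    have join: "(b, x) \<in> ?E" if x: "x \<in> N" and b: "b \<in> ?B" for x b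
    proof (rule ccontr)
      assume nadj: "(b, x) \<notin> ?E"
      obtain a where a: "a \<in> A" "(x, a) \<in> ?E" using N[OF x] by auto
      let ?R = "?E \<inter> insert x A \<times> insert x A"
      have AA: "(u, v) \<in> ?R\<^sup>*" if "u \<in> A" "v \<in> A" for u v
        using \<open>conn A\<close> that rtrancl_mono[of "?E \<inter> A \<times> A" ?R] by (auto simp: conn_def)
      have "(x, a) \<in> ?R" "(a, x) \<in> ?R" using a sym[OF a(2)] by auto
      then have xA: "(x, v) \<in> ?R\<^sup>*" "(v, x) \<in> ?R\<^sup>*" if "v \<in> A" for v
        using AA[OF a(1) that] AA[OF that a(1)]
        by (auto intro: converse_rtrancl_into_rtrancl rtrancl_into_rtrancl)
      have "conn (insert x A)" unfolding conn_def using AA xA by auto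
      moreover have "b \<in> far (insert x A)" using b nadj x by (auto simp: far_def N_def)
      ultimately have "insert x A \<in> \<A>" using x A(1) by (auto simp: \<A>_def N_def)
      from max[OF this] x show False by (auto simp: N_def)
    qed
    have clN: "(x, y) \<in> ?E" if x: "x \<in> N" and y: "y \<in> N" and "x \<noteq> y" for x y
    proof -
      obtain b where b: "b \<in> ?B" using A(4) by auto
      obtain c d where c: "c \<in> A" "(x, c) \<in> ?E" and d: "d \<in> A" "(y, d) \<in> ?E"
        using N[OF x] N[OF y] by auto
      let ?R = "?E \<inter> (A \<union> {x, y}) \<times> (A \<union> {x, y})"
      have "(c, d) \<in> ?R\<^sup>*"
        using \<open>conn A\<close> c d rtrancl_mono[of "?E \<inter> A \<times> A" ?R] by (auto simp: conn_def)
      moreover have "(x, c) \<in> ?R" "(d, y) \<in> ?R" using c d sym[OF d(2)] by auto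
      ultimately have "(x, y) \<in> ?R\<^sup>*"
        by (meson converse_rtrancl_into_rtrancl rtrancl_into_rtrancl)
      then show ?thesis
        using chordal_common_nbrs_adjacent[OF G, of x y A b] join[OF x b] join[OF y b] b \<open>x \<noteq> y\<close>
        by (auto simp: far_def)
    qed
    have "card ?B < card W"
      using A(1,2) less.prems by (intro psubset_card_mono) (auto simp: far_def)
    moreover have "finite ?B" using less.prems by (auto simp: far_def)
    ultimately obtain b where b: "simplicial ?E ?B b" using less.hyps A(4) by blast
    have bB: "b \<in> ?B" using b by (simp add: simplicial_def)
    have "(x, y) \<in> ?E" if "(b, x) \<in> ?E" "(b, y) \<in> ?E" "x \<in> W" "y \<in> W" "x \<noteq> y" for x y
    proof -
      have "x \<notin> A" "y \<notin> A" using that bB by (auto simp: far_def)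
      then have "x \<in> N \<union> ?B" "y \<in> N \<union> ?B" using that by (simp_all add: N_def)
      then consider "x \<in> N" "y \<in> N" | "x \<in> N" "y \<in> ?B" | "x \<in> ?B" "y \<in> N" | "x \<in> ?B" "y \<in> ?B"
        by blast
      then show ?thesis
      proof cases
        case 1 then show ?thesis using clN \<open>x \<noteq> y\<close> by simp
      next
        case 2 then show ?thesis using sym[OF join] by blast
      next
        case 3 then show ?thesis using join by simp
      next
        case 4 then show ?thesis using b that unfolding simplicial_def clique_def by blast
      qed
    qed
    moreover have "b \<in> W" using bB by (simp add: far_def)
    ultimately have "simplicial ?E W b" unfolding simplicial_def clique_def by blast
    then show ?thesis ..
  qed
qed

section \<open>Separating sets\<close>

text \<open>
  Connectedness as the absence of an empty cut. In this form it passes to subsets without any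
  handling of paths.
\<close>
definition connected_on :: "'a rel \<Rightarrow> 'a set \<Rightarrow> bool" where
  "connected_on E W \<longleftrightarrow> (\<forall>A. A \<subseteq> W \<and> A \<noteq> {} \<and> A \<noteq> W \<longrightarrow> (\<exists>x\<in>A. \<exists>y\<in>W - A. (x, y) \<in> E))"

lemma connected_induce_subgraph_iff:
  assumes "pair_graph G" and W: "W \<subseteq> pverts G" "W \<noteq> {}"
  shows "Digraph_Component.connected (induce_subgraph (with_proj G) W) \<longleftrightarrow>
    connected_on (parcs G) W"
proof -
  interpret pair_graph G by fact
  let ?R = "parcs G \<inter> W \<times> W"
  have sym: "(v, u) \<in> parcs G" if "(u, v) \<in> parcs G" for u v
    using that by (rule arcs_symmetric)
  have arcs: "parcs (mk_symmetric (induce_subgraph (with_proj G) W)) = ?R"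
    by (auto simp: parcs_mk_symmetric intro: sym)
  have conn: "Digraph_Component.connected (induce_subgraph (with_proj G) W) \<longleftrightarrow>
      (\<forall>u\<in>W. \<forall>v\<in>W. (u, v) \<in> rtrancl_on W ?R)"
    using W by (auto simp: connected_def strongly_connected_def reachable_def arcs)
  show ?thesis
  proof
    assume L: "Digraph_Component.connected (induce_subgraph (with_proj G) W)"
    show "connected_on (parcs G) W"
      unfolding connected_on_def
    proof (intro allI impI, rule ccontr)
      fix A assume A: "A \<subseteq> W \<and> A \<noteq> {} \<and> A \<noteq> W"
        and no: "\<not> (\<exists>x\<in>A. \<exists>y\<in>W - A. (x, y) \<in> parcs G)"
      then obtain u v where uv: "u \<in> A" "v \<in> W - A" by auto
      then have "(u, v) \<in> rtrancl_on W ?R" using L A conn by auto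
      then have "v \<in> A"
        using uv(1) no by (induction rule: rtrancl_on_induct) auto
      with uv show False by simp
    qed
  next
    assume R: "connected_on (parcs G) W"
    have "(u, v) \<in> rtrancl_on W ?R" if u: "u \<in> W" and v: "v \<in> W" for u v
    proof -
      define A where "A = {w \<in> W. (u, w) \<in> rtrancl_on W ?R}"
      have "A \<subseteq> W" "u \<in> A" using u by (simp_all add: A_def)
      moreover have "\<not> (\<exists>x\<in>A. \<exists>y\<in>W - A. (x, y) \<in> parcs G)"
      proof safe
        fix x y assume "x \<in> A" "y \<in> W" "(x, y) \<in> parcs G" "y \<notin> A"
        then show False
          using rtrancl_on_into_rtrancl_on[of u x W ?R y] by (simp add: A_def)
      qed
      ultimately have "A = W" using R unfolding connected_on_def by (metis empty_iff)
      then show ?thesis using v unfolding A_def by blast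
    qed
    then show "Digraph_Component.connected (induce_subgraph (with_proj G) W)"
      using conn by simp
  qed
qed

definition separation_free :: "nat \<Rightarrow> 'a rel \<Rightarrow> 'a set \<Rightarrow> bool" where
  "separation_free r E W \<longleftrightarrow> (\<forall>X. X \<subseteq> W \<and> card X = r \<longrightarrow> connected_on E (W - X))"

text \<open>
  On exactly \<open>r + 2\<close> vertices, deleting \<open>r\<close> of them leaves a pair, so that the absence of
  separating sets says that the graph is complete.
\<close>
lemma vertex_connected_iff_separation_free:
  assumes "pair_graph G" and card: "card (pverts G) \<ge> r + 2"
  shows "vertex_connected (r + 1) G \<longleftrightarrow> separation_free r (parcs G) (pverts G)"
proof -
  interpret pair_graph G by fact
  let ?V = "pverts G"
  have nonempty: "?V - X \<noteq> {}" if "card X = r" "X \<subseteq> ?V" for X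
    using that card by auto
  have deletion: "Digraph_Component.connected (induce_subgraph (with_proj G) (?V - X)) \<longleftrightarrow>
      connected_on (parcs G) (?V - X)" if "X \<subseteq> ?V" "card X = r" for X
    using nonempty that by (intro connected_induce_subgraph_iff \<open>pair_graph G\<close>) auto
  have complete: "complete_digraph (r + 1 + 1) (with_proj G) \<longleftrightarrow>
      card ?V = r + 2 \<and> separation_free r (parcs G) ?V"
  proof
    assume "complete_digraph (r + 1 + 1) (with_proj G)"
    then show "card ?V = r + 2 \<and> separation_free r (parcs G) ?V"
      unfolding complete_digraph_pair_def separation_free_def connected_on_def by auto blast
  next
    assume R: "card ?V = r + 2 \<and> separation_free r (parcs G) ?V"
    have "(u, v) \<in> parcs G" if "u \<in> ?V" "v \<in> ?V" "u \<noteq> v" for u v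
    proof -
      let ?X = "?V - {u, v}"
      have "card ?X = r" using that R by (simp add: card_Diff_subset)
      then have "connected_on (parcs G) (?V - ?X)" using R by (auto simp: separation_free_def)
      moreover have "?V - ?X = {u, v}" using that by auto
      ultimately have "connected_on (parcs G) {u, v}" by simp
      from this[unfolded connected_on_def, rule_format, of "{u}"] that(3) show ?thesis by auto
    qed
    then have "parcs G = {(u,v). (u,v) \<in> ?V \<times> ?V \<and> u \<noteq> v}"
      using pair_no_loops by (fastforce dest: in_arcsD1 in_arcsD2)
    then show "complete_digraph (r + 1 + 1) (with_proj G)"
      using R pair_finite_verts unfolding complete_digraph_pair_def by simp
  qed
  show ?thesis
    unfolding vertex_connected_def complete
    using deletion card by (auto simp: separation_free_def)
qed

text \<open>
  The neighbours of a simplicial vertex \<open>v\<close> form a clique, so those outside \<open>X\<close> all lie on one side of an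
  empty cut of \<open>W - {v} - X\<close>. Adding \<open>v\<close> to that side would give an empty cut
  of \<open>W - X\<close>.
\<close>
lemma separation_free_Diff_simplicial:
  assumes sf: "separation_free r E W" and v: "simplicial E W v" and "sym E"
  shows "separation_free r E (W - {v})"
  unfolding separation_free_def connected_on_def
proof (intro allI impI)
  fix X A
  assume X: "X \<subseteq> W - {v} \<and> card X = r"
    and A: "A \<subseteq> W - {v} - X \<and> A \<noteq> {} \<and> A \<noteq> W - {v} - X"
  have conn: "connected_on E (W - X)" using sf X by (auto simp: separation_free_def)
  have vW: "v \<in> W" and cl: "\<And>x y. (v, x) \<in> E \<Longrightarrow> (v, y) \<in> E \<Longrightarrow> x \<in> W \<Longrightarrow> y \<in> W \<Longrightarrow> x \<noteq> y \<Longrightarrow> (x, y) \<in> E"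
    using v by (auto simp: simplicial_def clique_def)
  show "\<exists>x\<in>A. \<exists>y\<in>W - {v} - X - A. (x, y) \<in> E"
  proof (cases "\<exists>a\<in>A. (v, a) \<in> E")
    case True
    then obtain a where a: "a \<in> A" "(v, a) \<in> E" by auto
    have "insert v A \<subseteq> W - X" "insert v A \<noteq> W - X" using A X vW by auto
    then obtain x y where xy: "x \<in> insert v A" "y \<in> W - X - insert v A" "(x, y) \<in> E"
      using conn unfolding connected_on_def by (metis insert_not_empty)
    then show ?thesis using cl[OF a(2), of y] a A by (cases "x = v") blast+
  next
    case False
    have "A \<subseteq> W - X" "A \<noteq> W - X" "A \<noteq> {}" using A X vW by auto
    then obtain x y where xy: "x \<in> A" "y \<in> W - X - A" "(x, y) \<in> E"
      using conn unfolding connected_on_def by metis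
    then have "y \<noteq> v" using False symD[OF \<open>sym E\<close>] by blast
    with xy show ?thesis by blast
  qed
qed

text \<open>
  At most \<open>r\<close> neighbours could be enlarged to a set of \<open>r\<close> vertices that isolates \<open>v\<close>.
\<close>
lemma simplicial_degree:
  assumes sf: "separation_free r E W" and v: "simplicial E W v"
    and W: "finite W" "card W \<ge> r + 2"
  shows "card (E `` {v} \<inter> (W - {v})) \<ge> r + 1"
proof (rule ccontr)
  let ?N = "E `` {v} \<inter> (W - {v})"
  have vW: "v \<in> W" using v by (simp add: simplicial_def)
  assume "\<not> card ?N \<ge> r + 1"
  then have "card ?N \<le> r" by simp
  moreover have "r \<le> card (W - {v})" using W vW by simp
  ultimately obtain X where X: "?N \<subseteq> X" "X \<subseteq> W - {v}" "card X = r"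
    using exists_subset_between[of ?N r "W - {v}"] W by auto
  then have "connected_on E (W - X)" using sf by (auto simp: separation_free_def)
  moreover have "{v} \<subseteq> W - X" using vW X by auto
  moreover have "{v} \<noteq> W - X"
  proof
    assume "{v} = W - X"
    then have "card (W - X) = 1" by (metis card_1_singleton_iff One_nat_def)
    moreover have "card (W - X) = card W - r"
      using X W by (subst card_Diff_subset) (auto intro: finite_subset)
    ultimately show False using W by simp
  qed
  ultimately show False using X unfolding connected_on_def by blast
qed

text \<open>
  One step of a perfect elimination: \<open>v\<close> is a simplicial vertex, and \<open>K\<close> consists of
  \<open>r + 1\<close> of its neighbours.
\<close>
lemma chordal_peel_vertex:
  assumes "pair_graph G" "chordal G" and W: "finite W" "card W \<ge> r + 2"
    and sf: "separation_free r (parcs G) W"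
  obtains v K where "v \<in> W" "K \<subseteq> W - {v}" "card K = r + 1" "clique (parcs G) (insert v K)"
    "separation_free r (parcs G) (W - {v})"
proof -
  interpret pair_graph G by fact
  have "W \<noteq> {}" using W by auto
  then obtain v where v: "simplicial (parcs G) W v"
    using chordal_has_simplicial_vertex assms by metis
  obtain K where K: "K \<subseteq> parcs G `` {v} \<inter> (W - {v})" "card K = r + 1"
    using obtain_subset_with_card_n[OF simplicial_degree[OF sf v W]] by metis
  have sym: "sym (parcs G)" by (auto simp: sym_def intro: arcs_symmetric)
  have "clique (parcs G) (insert v K)"
    unfolding clique_def
  proof (intro ballI impI)
    fix x y assume xy: "x \<in> insert v K" "y \<in> insert v K" "x \<noteq> y"
    have nbr: "(v, z) \<in> parcs G" if "z \<in> K" for z using K(1) that by auto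
    have "(x, y) \<in> parcs G" if "x \<in> K" "y \<in> K"
      using v K(1) that xy(3) unfolding simplicial_def clique_def by blast
    then show "(x, y) \<in> parcs G"
      using xy nbr symD[OF sym nbr] by (cases "x = v"; cases "y = v") simp_all
  qed
  with K v separation_free_Diff_simplicial[OF sf v sym] that[of v K] show ?thesis
    by (auto simp: simplicial_def)
qed

section \<open>Dual families and the rank of a matrix\<close>

text \<open>
  The square matrix \<open>(H i k)\<close> has trivial left kernel by assumption, and \<open>\<beta>\<close> is its
  two-sided inverse. The two conclusions are the two products.
\<close>
lemma dual_family:
  fixes H :: "'i \<Rightarrow> nat \<Rightarrow> real"
  assumes I: "finite I" "card I = Suc r"
    and indep: "\<And>c. (\<And>k. k \<le> r \<Longrightarrow> (\<Sum>i\<in>I. c i * H i k) = 0) \<Longrightarrow> \<forall>i\<in>I. c i = 0"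
  obtains \<beta> where
    "\<And>i j. i \<in> I \<Longrightarrow> j \<in> I \<Longrightarrow> (\<Sum>k\<le>r. \<beta> i k * H j k) = (if i = j then 1 else 0)"
    "\<And>k l. k \<le> r \<Longrightarrow> l \<le> r \<Longrightarrow> (\<Sum>i\<in>I. \<beta> i k * H i l) = (if k = l then 1 else 0)"
proof -
  let ?m = "Suc r"
  obtain e where e: "bij_betw e {..<?m} I"
    using I ex_bij_betw_nat_finite[of I] by (auto simp: atLeast0LessThan)
  define A where "A = mat ?m ?m (\<lambda>(k, i). H (e i) k)"
  have A: "A \<in> carrier_mat ?m ?m" by (simp add: A_def)
  have sumI: "(\<Sum>i\<in>I. f i) = (\<Sum>i<?m. f (e i))" for f :: "'i \<Rightarrow> real"
    by (rule sum.reindex_bij_betw[OF e, symmetric])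
  have inv: "inv_into {..<?m} e (e i) = i" if "i < ?m" for i
    using e that by (simp add: bij_betw_def inv_into_f_f)
  have "det A \<noteq> 0"
  proof
    assume "det A = 0"
    then obtain v where v: "v \<in> carrier_vec ?m" "v \<noteq> 0\<^sub>v ?m" "A *\<^sub>v v = 0\<^sub>v ?m"
      using det_0_iff_vec_prod_zero[OF A] by auto
    define c where "c i = v $ inv_into {..<?m} e i" for i
    have c: "c (e i) = v $ i" if "i < ?m" for i using inv[OF that] by (simp add: c_def)
    have "(\<Sum>i\<in>I. c i * H i k) = 0" if "k \<le> r" for k
    proof -
      have "(\<Sum>i\<in>I. c i * H i k) = (\<Sum>i<?m. v $ i * H (e i) k)"
        unfolding sumI by (intro sum.cong) (auto simp: c)
      also have "\<dots> = (A *\<^sub>v v) $ k"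
        using that v(1) by (simp add: A_def scalar_prod_def atLeast0LessThan mult.commute)
      finally show ?thesis using v(3) that by simp
    qed
    from indep[OF this] have "c i = 0" if "i \<in> I" for i using that by blast
    then have "v $ i = 0" if "i < ?m" for i
      using c[OF that] e that by (auto simp: bij_betw_def)
    then have "v = 0\<^sub>v ?m" using v(1) by auto
    with v(2) show False by simp
  qed
  from det_non_zero_imp_unit[OF A this, of "()"] obtain B where
    B: "B \<in> carrier_mat ?m ?m" "A * B = 1\<^sub>m ?m" "B * A = 1\<^sub>m ?m"
    by (auto simp: Units_def ring_mat_def)
  define \<beta> where "\<beta> i k = B $$ (inv_into {..<?m} e i, k)" for i k
  have \<beta>: "\<beta> (e i) k = B $$ (i, k)" if "i < ?m" for i k using inv[OF that] by (simp add: \<beta>_def)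
  show ?thesis
  proof
    fix i j assume "i \<in> I" "j \<in> I"
    then obtain i' j' where ij: "i = e i'" "j = e j'" "i' < ?m" "j' < ?m"
      using e by (auto simp: bij_betw_def)
    have "(\<Sum>k\<le>r. \<beta> i k * H j k) = (\<Sum>k<?m. B $$ (i', k) * A $$ (k, j'))"
      unfolding ij using ij(3,4) by (intro sum.cong) (auto simp: \<beta> A_def)
    also have "\<dots> = (B * A) $$ (i', j')"
      using ij(3,4) A B(1) by (simp add: scalar_prod_def atLeast0LessThan)
    also have "\<dots> = (if i = j then 1 else 0)"
      using ij inv by (auto simp: B(3)) metis
    finally show "(\<Sum>k\<le>r. \<beta> i k * H j k) = (if i = j then 1 else 0)" .
  next
    fix k l assume kl: "k \<le> r" "l \<le> r"
    have "(\<Sum>i\<in>I. \<beta> i k * H i l) = (\<Sum>i<?m. A $$ (l, i) * B $$ (i, k))"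
      unfolding sumI using kl by (intro sum.cong) (auto simp: \<beta> A_def)
    also have "\<dots> = (A * B) $$ (l, k)"
      using kl A B(1) by (simp add: scalar_prod_def atLeast0LessThan)
    finally show "(\<Sum>i\<in>I. \<beta> i k * H i l) = (if k = l then 1 else 0)"
      using kl by (auto simp: B(2))
  qed
qed

lemma rank_sum_products_le:
  fixes A :: "'a :: field mat"
  assumes "finite J" "A \<in> carrier_mat n nc"
    and "\<And>a b. a < n \<Longrightarrow> b < nc \<Longrightarrow> A $$ (a, b) = (\<Sum>j\<in>J. f j a * g j b)"
  shows "vec_space.rank n A \<le> card J"
  using assms
proof (induction J arbitrary: A rule: finite_induct)
  case empty
  interpret vec_space "TYPE('a)" n .
  have "A = 0\<^sub>m n nc" using empty by (intro eq_matI) auto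
  then show ?case by (simp add: rank_0I)
next
  case (insert j J)
  interpret vec_space "TYPE('a)" n .
  define B C where "B = mat n nc (\<lambda>(a, b). f j a * g j b)"
    and "C = mat n nc (\<lambda>(a, b). \<Sum>i\<in>J. f i a * g i b)"
  have BC: "B \<in> carrier_mat n nc" "C \<in> carrier_mat n nc" by (simp_all add: B_def C_def)
  have "A = B + C" using insert by (intro eq_matI) (auto simp: B_def C_def)
  then have "rank A \<le> rank B + rank C" using rank_subadditive[OF BC] by simp
  moreover have "rank B \<le> 1"
    by (rule rank_le_1_product_entries[OF BC(1), of "f j" "g j"]) (auto simp: B_def)
  moreover have "rank C \<le> card J" using BC(2) by (rule insert.IH) (auto simp: C_def)
  ultimately show ?case using insert by simp
qed

lemma rank_ge_card_columns:
  fixes A :: "'a :: field mat"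
  assumes A: "A \<in> carrier_mat n nc" and J: "J \<subseteq> {..<nc}"
    and indep: "\<And>y. (\<And>a. a < n \<Longrightarrow> (\<Sum>j\<in>J. A $$ (a, j) * y j) = 0) \<Longrightarrow> \<forall>j\<in>J. y j = 0"
  shows "card J \<le> vec_space.rank n A"
proof -
  interpret vec_space "TYPE('a)" n .
  have fin: "finite J" using J finite_subset by blast
  define js where "js = sorted_list_of_set J"
  have js: "set js = J" "distinct js" "length js = card J" using fin by (auto simp: js_def)
  define B where "B = mat_of_cols n (map (col A) js)"
  have B: "B \<in> carrier_mat n (card J)"
    by (rule carrier_matI) (simp_all add: B_def js)
  have sub: "set (map (col A) js) \<subseteq> carrier_vec n" using A by auto
  have cols: "cols B = map (col A) js" unfolding B_def using sub by simp
  have inj: "inj_on (col A) J"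
  proof (rule inj_onI, rule ccontr)
    fix i j assume ij: "i \<in> J" "j \<in> J" "col A i = col A j" "i \<noteq> j"
    define y :: "nat \<Rightarrow> 'a" where "y k = (if k = i then 1 else if k = j then -1 else 0)" for k
    have "(\<Sum>k\<in>J. A $$ (a, k) * y k) = 0" if "a < n" for a
    proof -
      have "(\<Sum>k\<in>J. A $$ (a, k) * y k) = (\<Sum>k\<in>{i, j}. A $$ (a, k) * y k)"
        using ij fin by (intro sum.mono_neutral_right) (auto simp: y_def)
      also have "\<dots> = col A i $ a - col A j $ a"
        using ij(4) A that subsetD[OF J ij(1)] subsetD[OF J ij(2)] by (simp add: y_def)
      finally show ?thesis using ij by simp
    qed
    from indep[OF this] ij(1) show False by (auto simp: y_def)
  qed
  then have dist: "distinct (cols B)" unfolding cols using js by (simp add: distinct_map)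
  have "lin_indpt (set (cols B))"
  proof
    assume "lin_dep (set (cols B))"
    then obtain v where
      v: "v \<in> carrier_vec (card J)" "v \<noteq> 0\<^sub>v (card J)" "B *\<^sub>v v = 0\<^sub>v n"
      by (rule lin_depE[OF B _ dist])
    have e: "bij_betw (\<lambda>i. js ! i) {..<card J} J"
      by (rule bij_betw_nth) (simp_all add: js)
    define y :: "nat \<Rightarrow> 'a" where "y j = v $ inv_into {..<card J} (\<lambda>i. js ! i) j" for j
    have y: "y (js ! i) = v $ i" if "i < card J" for i
      using e that by (simp add: y_def bij_betw_def inv_into_f_f)
    have "(\<Sum>j\<in>J. A $$ (a, j) * y j) = 0" if a: "a < n" for a
    proof -
      have "(\<Sum>j\<in>J. A $$ (a, j) * y j) = (\<Sum>i<card J. A $$ (a, js ! i) * v $ i)"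
        unfolding sum.reindex_bij_betw[OF e, symmetric] by (intro sum.cong) (auto simp: y)
      also have "\<dots> = (\<Sum>i<card J. B $$ (a, i) * v $ i)"
      proof (intro sum.cong refl)
        fix i assume "i \<in> {..<card J}"
        moreover from this have "js ! i < nc" using J js by (metis lessThan_iff nth_mem subsetD)
        ultimately show "A $$ (a, js ! i) * v $ i = B $$ (a, i) * v $ i"
          using a A by (simp add: B_def mat_of_cols_def js)
      qed
      also have "\<dots> = (B *\<^sub>v v) $ a"
        using a B v(1) by (simp add: scalar_prod_def atLeast0LessThan)
      finally show ?thesis using v(3) a by simp
    qed
    from indep[OF this] have "y (js ! i) = 0" if "i < card J" for i
      using js that by (metis nth_mem)
    then have "v = 0\<^sub>v (card J)" using v(1) y by auto
    with v(2) show False by simp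
  qed
  moreover have "set (cols B) \<subseteq> set (cols A)"
    unfolding cols using A J js by (auto simp: cols_def)
  ultimately have "card (set (cols B)) \<le> rank A" by (intro rank_ge_card_indpt[OF A])
  moreover have "card (set (cols B)) = card J"
    using distinct_card[OF dist] by (simp add: cols js)
  ultimately show ?thesis by simp
qed

text \<open>
  The kernel vector \<open>y i\<close> expresses the column \<open>i\<close> by the columns outside \<open>I\<close>, so
  the matrix is a sum of \<open>n - card I\<close> matrices of rank one.
\<close>
lemma rank_le_of_kernel_family:
  fixes s :: "nat \<Rightarrow> nat \<Rightarrow> real"
  assumes I: "I \<subseteq> {..<n}"
    and ker: "\<And>i a. i \<in> I \<Longrightarrow> a < n \<Longrightarrow> (\<Sum>j<n. s a j * y i j) = 0"
    and dual: "\<And>i j. i \<in> I \<Longrightarrow> j \<in> I \<Longrightarrow> y i j = (if i = j then 1 else 0)"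
  shows "vec_space.rank n (mat n n (\<lambda>(i, j). s i j)) \<le> n - card I"
proof -
  let ?J = "{..<n} - I"
  have fin: "finite I" using I finite_subset by blast
  have split: "(\<Sum>j<n. f j) = (\<Sum>j\<in>I. f j) + (\<Sum>j\<in>?J. f j)" for f :: "nat \<Rightarrow> real"
    using I by (simp add: sum.subset_diff add.commute)
  have "vec_space.rank n (mat n n (\<lambda>(i, j). s i j)) \<le> card ?J"
  proof (rule rank_sum_products_le[where f = "\<lambda>j a. s a j"
        and g = "\<lambda>j b. if b \<in> I then - y b j else if j = b then 1 else 0"])
    fix a b assume ab: "a < n" "b < n"
    have "s a b = (\<Sum>j\<in>?J. s a j * (if b \<in> I then - y b j else if j = b then 1 else 0))"
    proof (cases "b \<in> I")
      case True
      have "(\<Sum>j\<in>I. s a j * y b j) = (\<Sum>j\<in>I. if b = j then s a j else 0)"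
        using dual[OF True] by (intro sum.cong) auto
      also have "\<dots> = s a b" using True fin by simp
      finally show ?thesis using ker[OF True ab(1)] True by (simp add: split sum_negf)
    next
      case False
      have "(\<Sum>j\<in>?J. s a j * (if j = b then 1 else 0)) = (\<Sum>j\<in>?J. if j = b then s a j else 0)"
        by (intro sum.cong) auto
      then show ?thesis using False ab by simp
    qed
    then show "mat n n (\<lambda>(i, j). s i j) $$ (a, b) =
        (\<Sum>j\<in>?J. s a j * (if b \<in> I then - y b j else if j = b then 1 else 0))"
      using ab by simp
  qed auto
  then show ?thesis using I fin by (simp add: card_Diff_subset)
qed

text \<open>
  The kernel contains a family dual to \<open>I\<close>, so its dimension is at least \<open>card I\<close>, and it is
  larger iff some nonzero kernel vector vanishes on \<open>I\<close>. One direction computes the rank of a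
  constructed stress matrix, the other exploits a given rank.
\<close>
lemma rank_eq_iff_kernel_determined:
  fixes s :: "nat \<Rightarrow> nat \<Rightarrow> real"
  assumes I: "I \<subseteq> {..<n}"
    and ker: "\<And>i a. i \<in> I \<Longrightarrow> a < n \<Longrightarrow> (\<Sum>j<n. s a j * y i j) = 0"
    and dual: "\<And>i j. i \<in> I \<Longrightarrow> j \<in> I \<Longrightarrow> y i j = (if i = j then 1 else 0)"
  shows "vec_space.rank n (mat n n (\<lambda>(i, j). s i j)) = n - card I \<longleftrightarrow>
    (\<forall>x. (\<forall>a<n. (\<Sum>j<n. s a j * x j) = 0) \<and> (\<forall>i\<in>I. x i = 0) \<longrightarrow> (\<forall>i<n. x i = 0))"
    (is "?rank = _ \<longleftrightarrow> ?det")
proof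
  have fin: "finite I" using I finite_subset by blast
  assume rank: "?rank = n - card I"
  show ?det
  proof (intro allI impI, rule ccontr)
    fix x i0 assume x: "(\<forall>a<n. (\<Sum>j<n. s a j * x j) = 0) \<and> (\<forall>i\<in>I. x i = 0)"
      and i0: "i0 < n" "x i0 \<noteq> 0"
    \<comment> \<open>A dual family for \<open>I \<union> {i0}\<close>: scale \<open>x\<close> to the value 1 at \<open>i0\<close>, and use it to make the
      members of the old family vanish there.\<close>
    define z where "z i j = (if i = i0 then x j / x i0 else y i j - y i i0 * (x j / x i0))" for i j
    have notin: "i0 \<notin> I" using x i0 by auto
    have "?rank \<le> n - card (insert i0 I)"
    proof (rule rank_le_of_kernel_family[where y = z])
      show "insert i0 I \<subseteq> {..<n}" using I i0 by simp
      have kx: "(\<Sum>j<n. s a j * (c * (x j / x i0))) = 0" if "a < n" for a c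
      proof -
        have "(\<Sum>j<n. s a j * (c * (x j / x i0))) = (c / x i0) * (\<Sum>j<n. s a j * x j)"
          by (simp add: sum_distrib_left mult_ac)
        then show ?thesis using x that by simp
      qed
      show "(\<Sum>j<n. s a j * z i j) = 0" if "i \<in> insert i0 I" "a < n" for i a
        using that kx[of a 1] kx[of a "y i i0"] ker[of i a]
        by (cases "i = i0") (auto simp: z_def right_diff_distrib sum_subtractf)
      show "z i j = (if i = j then 1 else 0)" if "i \<in> insert i0 I" "j \<in> insert i0 I" for i j
        using that dual x i0(2) notin by (auto simp: z_def)
    qed
    moreover have "card (insert i0 I) \<le> n"
      using card_mono[of "{..<n}" "insert i0 I"] I i0 by simp
    ultimately show False using rank fin notin by simp
  qed
next
  have fin: "finite I" using I finite_subset by blast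
  assume det: ?det
  have "card ({..<n} - I) \<le> ?rank"
  proof (rule rank_ge_card_columns)
    fix x assume x: "\<And>a. a < n \<Longrightarrow> (\<Sum>j\<in>{..<n} - I. mat n n (\<lambda>(i, j). s i j) $$ (a, j) * x j) = 0"
    define x' where "x' j = (if j \<in> I then 0 else x j)" for j
    have "(\<Sum>j<n. s a j * x' j) = 0" if "a < n" for a
    proof -
      have "(\<Sum>j<n. s a j * x' j) = (\<Sum>j\<in>{..<n} - I. s a j * x' j)"
        by (rule sum.mono_neutral_right) (auto simp: x'_def)
      also have "\<dots> = (\<Sum>j\<in>{..<n} - I. mat n n (\<lambda>(i, j). s i j) $$ (a, j) * x j)"
        using that by (intro sum.cong) (auto simp: x'_def)
      finally show ?thesis using x[OF that] by simp
    qed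
    moreover have "\<forall>i\<in>I. x' i = 0" by (simp add: x'_def)
    ultimately have "\<forall>i<n. x' i = 0" using det[THEN spec, of x'] by blast
    then show "\<forall>j\<in>{..<n} - I. x j = 0" by (auto simp: x'_def split: if_splits)
  qed auto
  then have "n - card I \<le> ?rank" using I fin by (simp add: card_Diff_subset)
  moreover have "?rank \<le> n - card I" using assms by (rule rank_le_of_kernel_family)
  ultimately show "?rank = n - card I" by simp
qed

section \<open>Affine geometry in homogeneous coordinates\<close>

text \<open>
  The value 1 at the index \<open>k = r\<close> makes a point a vector of length \<open>r + 1\<close>. Affine functions become
  linear forms \<open>\<Sum>k\<le>r. \<beta> k * homog r x k\<close>, and the two conditions on an affine dependency (zero sum of
  coefficients, zero weighted sum of points) become one.
\<close>
definition homog :: "nat \<Rightarrow> real vec \<Rightarrow> nat \<Rightarrow> real" where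
  "homog r x k = (if k < r then x $ k else 1)"

lemma edist_coordinates:
  assumes "x \<in> carrier_vec r" "y \<in> carrier_vec r"
  shows "edist x y = sqrt (\<Sum>k<r. (x $ k - y $ k)\<^sup>2)"
  using assms by (simp add: edist_def scalar_prod_def power2_eq_square atLeast0LessThan)

lemma general_position_homog_independent:
  assumes gp: "general_position n r p" and p: "\<And>i. i < n \<Longrightarrow> p i \<in> carrier_vec r"
    and I: "I \<subseteq> {..<n}" "card I = Suc r"
    and zero: "\<And>k. k \<le> r \<Longrightarrow> (\<Sum>i\<in>I. c i * homog r (p i) k) = 0"
  shows "\<forall>i\<in>I. c i = 0"
proof -
  have fin: "finite I" using I(1) finite_subset by blast
  have pI: "(\<lambda>i. c i \<cdot>\<^sub>v p i) \<in> I \<rightarrow> carrier_vec r" using p I(1) by auto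
  have "finsum_vec TYPE(real) r (\<lambda>i. c i \<cdot>\<^sub>v p i) I = 0\<^sub>v r"
  proof (rule eq_vecI)
    fix k assume "k < dim_vec (0\<^sub>v r :: real vec)"
    then have k: "k < r" by simp
    have "finsum_vec TYPE(real) r (\<lambda>i. c i \<cdot>\<^sub>v p i) I $ k = (\<Sum>i\<in>I. (c i \<cdot>\<^sub>v p i) $ k)"
      by (rule index_finsum_vec[OF fin k pI])
    also have "\<dots> = (\<Sum>i\<in>I. c i * homog r (p i) k)"
    proof (rule sum.cong[OF refl])
      fix i assume "i \<in> I"
      then have "p i \<in> carrier_vec r" using p I(1) by auto
      then show "(c i \<cdot>\<^sub>v p i) $ k = c i * homog r (p i) k" using k by (simp add: homog_def)
    qed
    finally show "finsum_vec TYPE(real) r (\<lambda>i. c i \<cdot>\<^sub>v p i) I $ k = 0\<^sub>v r $ k"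
      using zero[of k] k by simp
  next
    show "dim_vec (finsum_vec TYPE(real) r (\<lambda>i. c i \<cdot>\<^sub>v p i) I) = dim_vec (0\<^sub>v r :: real vec)"
      using finsum_vec_closed[OF pI] by simp
  qed
  moreover have "(\<Sum>i\<in>I. c i) = 0" using zero[of r] by (simp add: homog_def)
  moreover have "affinely_independent r I p"
    using gp I by (simp add: general_position_def)
  ultimately show ?thesis by (simp add: affinely_independent_def)
qed

text \<open>
  The barycentric coordinates \<open>\<mu> i x\<close> of \<open>x\<close> with respect to the simplex \<open>p i\<close>, \<open>i \<in> I\<close>. Both
  roles are needed: as affine functions of \<open>x\<close>, which every stress annihilates, and as
  coefficients that reproduce \<open>x\<close>.
\<close>
lemma barycentric_coordinates:
  assumes gp: "general_position n r p" and p: "\<And>i. i < n \<Longrightarrow> p i \<in> carrier_vec r"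
    and I: "I \<subseteq> {..<n}" "card I = Suc r"
  obtains \<beta> \<mu> where "\<And>i x. \<mu> i x = (\<Sum>k\<le>r. \<beta> i k * homog r x k)"
    "\<And>i j. i \<in> I \<Longrightarrow> j \<in> I \<Longrightarrow> \<mu> i (p j) = (if i = j then 1 else 0)"
    "\<And>x k. k \<le> r \<Longrightarrow> (\<Sum>i\<in>I. \<mu> i x * homog r (p i) k) = homog r x k"
proof -
  have fin: "finite I" using I(1) finite_subset by blast
  obtain \<beta> where \<beta>:
    "\<And>i j. i \<in> I \<Longrightarrow> j \<in> I \<Longrightarrow> (\<Sum>k\<le>r. \<beta> i k * homog r (p j) k) = (if i = j then 1 else 0)"
    "\<And>k l. k \<le> r \<Longrightarrow> l \<le> r \<Longrightarrow> (\<Sum>i\<in>I. \<beta> i k * homog r (p i) l) = (if k = l then 1 else 0)"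
  proof (rule dual_family[OF fin I(2), of "\<lambda>i. homog r (p i)"])
    show "\<forall>i\<in>I. c i = 0" if "\<And>k. k \<le> r \<Longrightarrow> (\<Sum>i\<in>I. c i * homog r (p i) k) = 0" for c
      using general_position_homog_independent[OF gp p I that] by blast
  qed blast
  show ?thesis
  proof (rule that[of "\<lambda>i x. \<Sum>k\<le>r. \<beta> i k * homog r x k" \<beta>])
    show "(\<Sum>i\<in>I. (\<Sum>k\<le>r. \<beta> i k * homog r x k) * homog r (p i) l) = homog r x l"
      if l: "l \<le> r" for x l
    proof -
      have "(\<Sum>i\<in>I. (\<Sum>k\<le>r. \<beta> i k * homog r x k) * homog r (p i) l) =
          (\<Sum>i\<in>I. \<Sum>k\<le>r. homog r x k * (\<beta> i k * homog r (p i) l))"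
        unfolding sum_distrib_right by (simp add: mult_ac)
      also have "\<dots> = (\<Sum>k\<le>r. \<Sum>i\<in>I. homog r x k * (\<beta> i k * homog r (p i) l))"
        by (rule sum.swap)
      also have "\<dots> = (\<Sum>k\<le>r. homog r x k * (\<Sum>i\<in>I. \<beta> i k * homog r (p i) l))"
        by (simp add: sum_distrib_left)
      also have "\<dots> = (\<Sum>k\<le>r. if k = l then homog r x k else 0)"
        using \<beta>(2) l by (intro sum.cong) auto
      also have "\<dots> = homog r x l" using l by simp
      finally show ?thesis .
    qed
  qed (use \<beta>(1) in auto)
qed

lemma affinely_spans_if_agrees_on_simplex:
  assumes gp: "general_position n r p" and p: "\<And>i. i < n \<Longrightarrow> p i \<in> carrier_vec r"
    and I: "I \<subseteq> {..<n}" "card I = Suc r"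
    and q: "\<And>i. i < n \<Longrightarrow> q i \<in> carrier_vec r" "\<And>i. i \<in> I \<Longrightarrow> q i = p i"
  shows "affinely_spans n r q"
proof -
  obtain \<beta> \<mu> where
    bary: "\<And>x k. k \<le> r \<Longrightarrow> (\<Sum>i\<in>I. \<mu> i x * homog r (p i) k) = homog r x k"
    using barycentric_coordinates[OF gp p I] by metis
  show ?thesis
    unfolding affinely_spans_def
  proof (intro ballI exI conjI)
    fix x :: "real vec" assume x: "x \<in> carrier_vec r"
    let ?c = "\<lambda>i. if i \<in> I then \<mu> i x else 0"
    have restrict: "(\<Sum>i<n. ?c i * homog r (q i) k) = homog r x k" if "k \<le> r" for k
    proof -
      have "(\<Sum>i<n. ?c i * homog r (q i) k) = (\<Sum>i\<in>I. ?c i * homog r (q i) k)"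
        using I(1) by (intro sum.mono_neutral_right) auto
      also have "\<dots> = (\<Sum>i\<in>I. \<mu> i x * homog r (p i) k)"
        using q(2) by (intro sum.cong) auto
      finally show ?thesis using bary[OF that] by simp
    qed
    show "(\<Sum>i<n. ?c i) = 1" using restrict[of r] by (simp add: homog_def)
    have qI: "(\<lambda>i. ?c i \<cdot>\<^sub>v q i) \<in> {..<n} \<rightarrow> carrier_vec r" using q(1) by auto
    show "finsum_vec TYPE(real) r (\<lambda>i. ?c i \<cdot>\<^sub>v q i) {..<n} = x"
    proof (rule eq_vecI)
      fix k assume "k < dim_vec x"
      then have k: "k < r" using x by simp
      have "finsum_vec TYPE(real) r (\<lambda>i. ?c i \<cdot>\<^sub>v q i) {..<n} $ k = (\<Sum>i<n. (?c i \<cdot>\<^sub>v q i) $ k)"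
        by (rule index_finsum_vec[OF _ k qI]) simp
      also have "\<dots> = (\<Sum>i<n. ?c i * homog r (q i) k)"
      proof (rule sum.cong[OF refl])
        fix i assume "i \<in> {..<n}"
        then have "q i \<in> carrier_vec r" using q(1) by auto
        then show "(?c i \<cdot>\<^sub>v q i) $ k = ?c i * homog r (q i) k" using k by (simp add: homog_def)
      qed
      also have "\<dots> = x $ k" using restrict[of k] k by (simp add: homog_def)
      finally show "finsum_vec TYPE(real) r (\<lambda>i. ?c i \<cdot>\<^sub>v q i) {..<n} $ k = x $ k" .
    next
      show "dim_vec (finsum_vec TYPE(real) r (\<lambda>i. ?c i \<cdot>\<^sub>v q i) {..<n}) = dim_vec x"
        using finsum_vec_closed[OF qI] x by simp
    qed
  qed
qed

section \<open>Positive semidefinite quadratic forms\<close>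

definition quad_form :: "nat \<Rightarrow> (nat \<Rightarrow> nat \<Rightarrow> real) \<Rightarrow> (nat \<Rightarrow> real) \<Rightarrow> real" where
  "quad_form n s x = (\<Sum>i<n. x i * (\<Sum>j<n. s i j * x j))"

text \<open>
  Expand \<open>(x i - x j)\<^sup>2\<close>: by symmetry and zero row sums, both square terms cancel in the sum.
  For a stress this is the energy as a function of distances; for the rank one form
  \<open>c i * c j\<close> it expresses distances between affine combinations.
\<close>
lemma quadratic_form_zero_row_sums:
  fixes s :: "'i \<Rightarrow> 'i \<Rightarrow> real"
  assumes sym: "\<And>i j. i \<in> I \<Longrightarrow> j \<in> I \<Longrightarrow> s i j = s j i"
    and rows: "\<And>i. i \<in> I \<Longrightarrow> (\<Sum>j\<in>I. s i j) = 0"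
  shows "(\<Sum>i\<in>I. x i * (\<Sum>j\<in>I. s i j * x j)) = - (\<Sum>i\<in>I. \<Sum>j\<in>I. s i j * (x i - x j)\<^sup>2) / 2"
proof -
  have 1: "(\<Sum>i\<in>I. \<Sum>j\<in>I. s i j * (x i)\<^sup>2) = 0"
    using rows by (simp add: sum_distrib_right[symmetric])
  have "(\<Sum>i\<in>I. \<Sum>j\<in>I. s i j * (x j)\<^sup>2) = (\<Sum>j\<in>I. \<Sum>i\<in>I. s i j * (x j)\<^sup>2)"
    by (rule sum.swap)
  also have "\<dots> = (\<Sum>j\<in>I. \<Sum>i\<in>I. s j i * (x j)\<^sup>2)"
    using sym by (intro sum.cong) auto
  finally have 2: "(\<Sum>i\<in>I. \<Sum>j\<in>I. s i j * (x j)\<^sup>2) = 0" using 1 by simp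
  have "(\<Sum>i\<in>I. \<Sum>j\<in>I. s i j * (x i - x j)\<^sup>2) =
      (\<Sum>i\<in>I. \<Sum>j\<in>I. s i j * (x i)\<^sup>2 + s i j * (x j)\<^sup>2 - 2 * (x i * (s i j * x j)))"
    by (intro sum.cong refl) (simp add: power2_eq_square algebra_simps)
  also have "\<dots> = (\<Sum>i\<in>I. \<Sum>j\<in>I. s i j * (x i)\<^sup>2) + (\<Sum>i\<in>I. \<Sum>j\<in>I. s i j * (x j)\<^sup>2)
      - 2 * (\<Sum>i\<in>I. x i * (\<Sum>j\<in>I. s i j * x j))"
    by (simp only: sum.distrib sum_subtractf sum_distrib_left)
  finally have "(\<Sum>i\<in>I. \<Sum>j\<in>I. s i j * (x i - x j)\<^sup>2) = \<dots>" .
  then show ?thesis using 1 2 by simp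
qed

text \<open>
  A zero of a nonnegative form is a minimum, so the derivative there, \<open>2 S x\<close>, vanishes.
  In elementary terms: moving from \<open>x\<close> in the direction \<open>y = S x\<close>, the form is
  \<open>2 t |y|\<^sup>2 + O(t\<^sup>2)\<close>, which is negative for small \<open>t < 0\<close> unless \<open>y = 0\<close>.
\<close>
lemma kernel_if_quad_form_zero:
  assumes sym: "\<And>i j. i < n \<Longrightarrow> j < n \<Longrightarrow> s i j = s j i"
    and psd: "\<And>x. quad_form n s x \<ge> 0" and zero: "quad_form n s x = 0" and a: "a < n"
  shows "(\<Sum>j<n. s a j * x j) = 0"
proof -
  define y where "y i = (\<Sum>j<n. s i j * x j)" for i
  define Y where "Y = (\<Sum>i<n. (y i)\<^sup>2)"
  have cross: "(\<Sum>i<n. x i * (\<Sum>j<n. s i j * y j)) = Y"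
  proof -
    have "(\<Sum>i<n. x i * (\<Sum>j<n. s i j * y j)) = (\<Sum>i<n. \<Sum>j<n. x i * s i j * y j)"
      by (simp add: sum_distrib_left mult_ac)
    also have "\<dots> = (\<Sum>j<n. \<Sum>i<n. x i * s i j * y j)" by (rule sum.swap)
    also have "\<dots> = (\<Sum>j<n. \<Sum>i<n. y j * (s j i * x i))"
      using sym by (intro sum.cong) auto
    also have "\<dots> = Y" by (simp add: Y_def y_def power2_eq_square sum_distrib_left)
    finally show ?thesis .
  qed
  have expand: "quad_form n s (\<lambda>i. x i + t * y i) = 2 * t * Y + t\<^sup>2 * quad_form n s y" for t
  proof -
    have "quad_form n s (\<lambda>i. x i + t * y i) =
        quad_form n s x + t * (\<Sum>i<n. x i * (\<Sum>j<n. s i j * y j))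
        + t * (\<Sum>i<n. y i * (\<Sum>j<n. s i j * x j)) + t\<^sup>2 * quad_form n s y"
    proof -
      have "(\<Sum>j<n. s i j * (x j + t * y j)) = (\<Sum>j<n. s i j * x j) + t * (\<Sum>j<n. s i j * y j)" for i
        by (simp add: sum.distrib sum_distrib_left distrib_left mult.left_commute)
      then have "quad_form n s (\<lambda>i. x i + t * y i) = (\<Sum>i<n.
          x i * (\<Sum>j<n. s i j * x j) + t * (x i * (\<Sum>j<n. s i j * y j))
          + t * (y i * (\<Sum>j<n. s i j * x j)) + t\<^sup>2 * (y i * (\<Sum>j<n. s i j * y j)))"
        unfolding quad_form_def
        by (intro sum.cong refl) (simp only: power2_eq_square, simp add: algebra_simps)
      then show ?thesis unfolding quad_form_def sum_distrib_left sum.distrib .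
    qed
    then show ?thesis
      using zero cross by (simp add: Y_def power2_eq_square y_def[symmetric])
  qed
  have "Y = 0"
  proof (rule ccontr)
    assume "Y \<noteq> 0"
    moreover have "Y \<ge> 0" by (simp add: Y_def sum_nonneg)
    ultimately have Y: "Y > 0" by simp
    define q where "q = quad_form n s y"
    have q: "q \<ge> 0" using psd by (simp add: q_def)
    \<comment> \<open>Any \<open>t < 0\<close> of absolute value below \<open>2 Y / q\<close> will do; adding 1 avoids the case \<open>q = 0\<close>.\<close>
    define t where "t = - Y / (q + 1)"
    have "0 \<le> 2 * t * Y + t\<^sup>2 * q" using psd[of "\<lambda>i. x i + t * y i"] expand[of t] by (simp add: q_def)
    also have "\<dots> = - (Y\<^sup>2 * (q + 2) / (q + 1)\<^sup>2)"
      using q by (simp add: t_def power2_eq_square divide_simps) (simp add: algebra_simps)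
    also have "\<dots> < 0" using Y q by simp
    finally show False by simp
  qed
  then have "(y a)\<^sup>2 = 0" using a by (simp add: Y_def sum_nonneg_eq_0_iff)
  then show ?thesis by (simp add: y_def)
qed

lemma positive_semidefinite_mat_iff:
  "positive_semidefinite n (mat n n (\<lambda>(i, j). s i j)) \<longleftrightarrow>
    (\<forall>i<n. \<forall>j<n. s i j = s j i) \<and> (\<forall>x. quad_form n s x \<ge> 0)"
proof -
  let ?S = "mat n n (\<lambda>(i, j). s i j)"
  have sym: "transpose_mat ?S = ?S \<longleftrightarrow> (\<forall>i<n. \<forall>j<n. s i j = s j i)"
    by (auto simp: mat_eq_iff)
  have form: "vec n x \<bullet> (?S *\<^sub>v vec n x) = quad_form n s x" for x
    by (simp add: scalar_prod_def quad_form_def atLeast0LessThan)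
  have all: "(\<forall>x\<in>carrier_vec n. x \<bullet> (?S *\<^sub>v x) \<ge> 0) \<longleftrightarrow> (\<forall>x. quad_form n s x \<ge> 0)"
  proof
    assume L: "\<forall>x\<in>carrier_vec n. x \<bullet> (?S *\<^sub>v x) \<ge> 0"
    show "\<forall>x. quad_form n s x \<ge> 0"
      using L[rule_format, OF vec_carrier] unfolding form by blast
  next
    assume R: "\<forall>x. quad_form n s x \<ge> 0"
    show "\<forall>x\<in>carrier_vec n. x \<bullet> (?S *\<^sub>v x) \<ge> 0"
    proof
      fix x :: "real vec" assume "x \<in> carrier_vec n"
      then have "x = vec n (\<lambda>i. x $ i)" by auto
      then show "x \<bullet> (?S *\<^sub>v x) \<ge> 0" using R form by metis
    qed
  qed
  show ?thesis unfolding positive_semidefinite_def sym all by simp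
qed

section \<open>Stress matrices and their kernels\<close>

text \<open>
  A stress matrix acts as the weighted graph Laplacian.
\<close>
lemma stress_matrix_of_mult:
  assumes G: "pair_graph G" "pverts G = {..<n}" and i: "i < n"
  shows "(\<Sum>j<n. stress_matrix_of n G \<omega> $$ (i, j) * f j) =
    (\<Sum>j | (i, j) \<in> parcs G. \<omega> i j * (f i - f j))"
proof -
  interpret pair_graph G by fact
  let ?N = "{j. (i, j) \<in> parcs G}"
  have N: "?N \<subseteq> {..<n} - {i}"
    using in_arcsD2 pair_no_loops[of "(i, i)"] by (auto simp: G(2))
  have "(\<Sum>j\<in>{..<n} - {i}. stress_matrix_of n G \<omega> $$ (i, j) * f j) =
      (\<Sum>j\<in>?N. stress_matrix_of n G \<omega> $$ (i, j) * f j)"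
    using N i by (intro sum.mono_neutral_right) (auto simp: stress_matrix_of_def)
  also have "\<dots> = (\<Sum>j\<in>?N. - (\<omega> i j * f j))"
  proof (rule sum.cong[OF refl])
    fix j assume j: "j \<in> ?N"
    then have "j < n" "j \<noteq> i" using N by auto
    then show "stress_matrix_of n G \<omega> $$ (i, j) * f j = - (\<omega> i j * f j)"
      using i j by (simp add: stress_matrix_of_def)
  qed
  finally have "(\<Sum>j<n. stress_matrix_of n G \<omega> $$ (i, j) * f j) =
      (\<Sum>j\<in>?N. \<omega> i j) * f i - (\<Sum>j\<in>?N. \<omega> i j * f j)"
    using i by (subst sum.remove[of _ i]) (auto simp: stress_matrix_of_def sum_negf)
  also have "\<dots> = (\<Sum>j\<in>?N. \<omega> i j * (f i - f j))"
    by (simp add: sum_distrib_right sum_subtractf[symmetric] right_diff_distrib)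
  finally show ?thesis .
qed

text \<open>
  The entries of a stress matrix, characterized by themselves: symmetric, supported on edges and
  the diagonal, and annihilating the homogeneous coordinates of the configuration. The coordinate
  \<open>k = r\<close> says that the row sums vanish.
\<close>
definition stress_function ::
  "nat \<Rightarrow> nat \<Rightarrow> nat pair_pre_digraph \<Rightarrow> (nat \<Rightarrow> real vec) \<Rightarrow> (nat \<Rightarrow> nat \<Rightarrow> real) \<Rightarrow> bool" where
  "stress_function n r G p s \<longleftrightarrow>
    (\<forall>i<n. \<forall>j<n. s i j = s j i) \<and>
    (\<forall>i<n. \<forall>j<n. i \<noteq> j \<and> (i, j) \<notin> parcs G \<longrightarrow> s i j = 0) \<and>
    (\<forall>i<n. \<forall>k\<le>r. (\<Sum>j<n. s i j * homog r (p j) k) = 0)"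

lemma stress_functionD:
  assumes "stress_function n r G p s" "i < n"
  shows "j < n \<Longrightarrow> s i j = s j i"
    and "j < n \<Longrightarrow> i \<noteq> j \<Longrightarrow> (i, j) \<notin> parcs G \<Longrightarrow> s i j = 0"
    and "k \<le> r \<Longrightarrow> (\<Sum>j<n. s i j * homog r (p j) k) = 0"
  using assms unfolding stress_function_def by blast+

lemma equilibrium_iff_coordinates:
  assumes G: "pair_graph G" "pverts G = {..<n}"
    and p: "\<And>i. i < n \<Longrightarrow> p i \<in> carrier_vec r" and i: "i < n"
  shows "finsum_vec TYPE(real) r (\<lambda>j. \<omega> i j \<cdot>\<^sub>v (p i - p j)) {j. (i, j) \<in> parcs G} = 0\<^sub>v r \<longleftrightarrow>
    (\<forall>k\<le>r. (\<Sum>j<n. stress_matrix_of n G \<omega> $$ (i, j) * homog r (p j) k) = 0)"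
proof -
  interpret pair_graph G by fact
  let ?N = "{j. (i, j) \<in> parcs G}"
  let ?v = "finsum_vec TYPE(real) r (\<lambda>j. \<omega> i j \<cdot>\<^sub>v (p i - p j)) ?N"
  have N: "?N \<subseteq> {..<n}" using in_arcsD2 by (auto simp: G(2))
  then have fin: "finite ?N" by (rule finite_subset) simp
  have pN: "(\<lambda>j. \<omega> i j \<cdot>\<^sub>v (p i - p j)) \<in> ?N \<rightarrow> carrier_vec r" using p i N by auto
  have dim: "dim_vec ?v = r" using finsum_vec_closed[OF pN] by simp
  have coord: "?v $ k = (\<Sum>j<n. stress_matrix_of n G \<omega> $$ (i, j) * homog r (p j) k)" if k: "k < r" for k
  proof -
    have "?v $ k = (\<Sum>j\<in>?N. (\<omega> i j \<cdot>\<^sub>v (p i - p j)) $ k)"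
      by (rule index_finsum_vec[OF fin k pN])
    also have "\<dots> = (\<Sum>j\<in>?N. \<omega> i j * (homog r (p i) k - homog r (p j) k))"
    proof (rule sum.cong[OF refl])
      fix j assume "j \<in> ?N"
      then have "p i \<in> carrier_vec r" "p j \<in> carrier_vec r" using p i N by auto
      then show "(\<omega> i j \<cdot>\<^sub>v (p i - p j)) $ k = \<omega> i j * (homog r (p i) k - homog r (p j) k)"
        using k by (simp add: homog_def)
    qed
    finally show ?thesis using stress_matrix_of_mult[OF G i] by simp
  qed
  have const: "(\<Sum>j<n. stress_matrix_of n G \<omega> $$ (i, j) * homog r (p j) r) = 0"
    using stress_matrix_of_mult[OF G i, of \<omega> "\<lambda>j. homog r (p j) r"] by (simp add: homog_def)
  have "?v = 0\<^sub>v r \<longleftrightarrow> (\<forall>k<r. ?v $ k = 0)" using dim by (auto simp: vec_eq_iff)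
  then show ?thesis using coord const by (auto simp: le_less)
qed

lemma stress_matrix_iff:
  assumes G: "pair_graph G" "pverts G = {..<n}"
    and p: "\<And>i. i < n \<Longrightarrow> p i \<in> carrier_vec r"
  shows "stress_matrix n r G p S \<longleftrightarrow>
    (\<exists>s. stress_function n r G p s \<and> S = mat n n (\<lambda>(i, j). s i j))"
proof -
  interpret pair_graph G by fact
  have sym: "(j, i) \<in> parcs G" if "(i, j) \<in> parcs G" for i j
    using that by (rule arcs_symmetric)
  show ?thesis
  proof
    assume "stress_matrix n r G p S"
    then obtain \<omega> where \<omega>: "equilibrium_stress n r G p \<omega>" and S: "S = stress_matrix_of n G \<omega>"
      by (auto simp: stress_matrix_def)
    let ?s = "\<lambda>i j. stress_matrix_of n G \<omega> $$ (i, j)"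
    have "?s i j = ?s j i" if "i < n" "j < n" for i j
    proof (cases "(i, j) \<in> parcs G")
      case True
      then have "\<omega> i j = \<omega> j i" using \<omega> by (auto simp: equilibrium_stress_def)
      then show ?thesis using True sym[OF True] that by (simp add: stress_matrix_of_def)
    next
      case False
      then have "(j, i) \<notin> parcs G" using sym by blast
      then show ?thesis using False that by (simp add: stress_matrix_of_def)
    qed
    moreover have "?s i j = 0" if "i < n" "j < n" "i \<noteq> j" "(i, j) \<notin> parcs G" for i j
      using that by (simp add: stress_matrix_of_def)
    moreover have "(\<Sum>j<n. ?s i j * homog r (p j) k) = 0" if "i < n" "k \<le> r" for i k
      using \<omega> that equilibrium_iff_coordinates[where p = p, OF G p that(1)] by (auto simp: equilibrium_stress_def)
    ultimately have "stress_function n r G p ?s" by (simp add: stress_function_def)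
    moreover have "S = mat n n (\<lambda>(i, j). ?s i j)"
      by (rule eq_matI) (auto simp: S stress_matrix_of_def)
    ultimately show "\<exists>s. stress_function n r G p s \<and> S = mat n n (\<lambda>(i, j). s i j)"
      by (intro exI[of _ ?s]) simp
  next
    assume "\<exists>s. stress_function n r G p s \<and> S = mat n n (\<lambda>(i, j). s i j)"
    then obtain s where s: "stress_function n r G p s" and S: "S = mat n n (\<lambda>(i, j). s i j)" by auto
    define \<omega> where "\<omega> i j = - s i j" for i j
    have off: "s i j = 0" if "i < n" "j < n" "i \<noteq> j" "(i, j) \<notin> parcs G" for i j
      using s that unfolding stress_function_def by blast
    have diag: "s i i = (\<Sum>j | (i, j) \<in> parcs G. \<omega> i j)" if i: "i < n" for i
    proof -
      have "(i, i) \<notin> parcs G" using pair_no_loops[of "(i, i)"] by auto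
      then have N: "{j. (i, j) \<in> parcs G} \<subseteq> {..<n} - {i}" using in_arcsD2 by (auto simp: G(2))
      have "(\<Sum>j<n. s i j) = 0"
        using s i unfolding stress_function_def by (metis (no_types, lifting) homog_def
            less_irrefl mult.right_neutral order_refl sum.cong)
      then have "s i i = - (\<Sum>j\<in>{..<n} - {i}. s i j)"
        using i by (subst (asm) sum.remove[of _ i]) auto
      also have "(\<Sum>j\<in>{..<n} - {i}. s i j) = (\<Sum>j | (i, j) \<in> parcs G. s i j)"
        using off[OF i] N by (intro sum.mono_neutral_right) auto
      finally show ?thesis by (simp add: \<omega>_def sum_negf)
    qed
    have entries: "stress_matrix_of n G \<omega> $$ (i, j) = s i j" if "i < n" "j < n" for i j
      using that diag off by (auto simp: stress_matrix_of_def \<omega>_def)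
    have "\<omega> i j = \<omega> j i" if "(i, j) \<in> parcs G" for i j
      using s in_arcsD1[OF that] in_arcsD2[OF that] by (simp add: \<omega>_def stress_function_def G(2))
    moreover have "finsum_vec TYPE(real) r (\<lambda>j. \<omega> i j \<cdot>\<^sub>v (p i - p j)) {j. (i, j) \<in> parcs G} = 0\<^sub>v r"
      if i: "i < n" for i
    proof -
      have "(\<Sum>j<n. s i j * homog r (p j) k) = 0" if "k \<le> r" for k
        using s i that unfolding stress_function_def by blast
      then show ?thesis
        using equilibrium_iff_coordinates[where p = p, OF G p i, of \<omega>] entries[OF i] by simp
    qed
    ultimately have "equilibrium_stress n r G p \<omega>" by (auto simp: equilibrium_stress_def)
    moreover have "S = stress_matrix_of n G \<omega>"
      using entries by (intro eq_matI) (auto simp: S, auto simp: stress_matrix_of_def)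
    ultimately show "stress_matrix n r G p S" by (auto simp: stress_matrix_def)
  qed
qed

lemma stress_kills_affine_functions:
  assumes "stress_function n r G p s" "a < n"
  shows "(\<Sum>j<n. s a j * (\<Sum>k\<le>r. \<beta> k * homog r (p j) k)) = 0"
proof -
  have "(\<Sum>j<n. s a j * (\<Sum>k\<le>r. \<beta> k * homog r (p j) k)) =
      (\<Sum>j<n. \<Sum>k\<le>r. \<beta> k * (s a j * homog r (p j) k))"
    by (simp add: sum_distrib_left mult.left_commute)
  also have "\<dots> = (\<Sum>k\<le>r. \<Sum>j<n. \<beta> k * (s a j * homog r (p j) k))" by (rule sum.swap)
  also have "\<dots> = (\<Sum>k\<le>r. \<beta> k * (\<Sum>j<n. s a j * homog r (p j) k))" by (simp add: sum_distrib_left)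
  also have "\<dots> = 0" using stress_functionD(3)[OF assms] by simp
  finally show ?thesis .
qed

text \<open>
  The dual family in the kernel consists of the barycentric coordinate functions, evaluated
  at the configuration.
\<close>
lemma stress_rank_iff:
  assumes gp: "general_position n r p" and p: "\<And>i. i < n \<Longrightarrow> p i \<in> carrier_vec r"
    and I: "I \<subseteq> {..<n}" "card I = Suc r" and s: "stress_function n r G p s"
  shows "vec_space.rank n (mat n n (\<lambda>(i, j). s i j)) = n - r - 1 \<longleftrightarrow>
    (\<forall>x. (\<forall>a<n. (\<Sum>j<n. s a j * x j) = 0) \<and> (\<forall>i\<in>I. x i = 0) \<longrightarrow> (\<forall>i<n. x i = 0))"
proof -
  obtain \<beta> \<mu> where \<mu>: "\<And>i x. \<mu> i x = (\<Sum>k\<le>r. \<beta> i k * homog r x k)"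
    and dual: "\<And>i j. i \<in> I \<Longrightarrow> j \<in> I \<Longrightarrow> \<mu> i (p j) = (if i = j then 1 else 0)"
    by (rule barycentric_coordinates[OF gp p I]) blast+
  have "(\<Sum>j<n. s a j * \<mu> i (p j)) = 0" if "a < n" for i a
    unfolding \<mu> by (rule stress_kills_affine_functions[OF s that])
  from rank_eq_iff_kernel_determined[OF I(1), where s = s and y = "\<lambda>i j. \<mu> i (p j)", OF this dual]
  show ?thesis using I(2) by simp
qed

text \<open>
  The difference of the two sides lies in the kernel and vanishes on \<open>I\<close>.
\<close>
lemma kernel_vector_extrapolation:
  assumes gp: "general_position n r p" and p: "\<And>i. i < n \<Longrightarrow> p i \<in> carrier_vec r"
    and I: "I \<subseteq> {..<n}" "card I = Suc r" and s: "stress_function n r G p s"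
    and rank: "vec_space.rank n (mat n n (\<lambda>(i, j). s i j)) = n - r - 1"
    and \<mu>: "\<And>i x. \<mu> i x = (\<Sum>k\<le>r. \<beta> i k * homog r x k)"
    and dual: "\<And>i j. i \<in> I \<Longrightarrow> j \<in> I \<Longrightarrow> \<mu> i (p j) = (if i = j then 1 else 0)"
    and x: "\<And>a. a < n \<Longrightarrow> (\<Sum>j<n. s a j * x j) = 0" and j: "j < n"
  shows "x j = (\<Sum>i\<in>I. \<mu> i (p j) * x i)"
proof -
  have fin: "finite I" using I(1) finite_subset by blast
  define y where "y j = x j - (\<Sum>i\<in>I. \<mu> i (p j) * x i)" for j
  have "(\<Sum>j<n. s a j * y j) = 0" if a: "a < n" for a
  proof -
    have "(\<Sum>j<n. s a j * y j) = (\<Sum>j<n. s a j * x j) - (\<Sum>j<n. \<Sum>i\<in>I. x i * (s a j * \<mu> i (p j)))"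
      by (simp add: y_def right_diff_distrib sum_subtractf sum_distrib_left mult_ac)
    also have "(\<Sum>j<n. \<Sum>i\<in>I. x i * (s a j * \<mu> i (p j))) = (\<Sum>i\<in>I. \<Sum>j<n. x i * (s a j * \<mu> i (p j)))"
      by (rule sum.swap)
    also have "\<dots> = (\<Sum>i\<in>I. x i * (\<Sum>j<n. s a j * \<mu> i (p j)))" by (simp add: sum_distrib_left)
    also have "\<dots> = 0" unfolding \<mu> using stress_kills_affine_functions[OF s a] by simp
    finally show ?thesis using x[OF a] by simp
  qed
  moreover have "y i = 0" if i: "i \<in> I" for i
  proof -
    have "(\<Sum>l\<in>I. \<mu> l (p i) * x l) = (\<Sum>l\<in>I. if l = i then x l else 0)"
      using dual i by (intro sum.cong) auto
    then show ?thesis using i fin by (simp add: y_def)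
  qed
  ultimately have "y j = 0" using stress_rank_iff[OF gp p I s] rank j by blast
  then show ?thesis by (simp add: y_def)
qed

section \<open>Equivalent configurations and universal rigidity\<close>

text \<open>
  The energy is a combination of squared distances in which only the edges have nonzero
  coefficients.
\<close>
lemma stress_energy_eq_if_equivalent:
  assumes G: "pair_graph G" "pverts G = {..<n}" and s: "stress_function n r G p s"
    and p: "\<And>i. i < n \<Longrightarrow> p i \<in> carrier_vec r" and q: "\<And>i. i < n \<Longrightarrow> q i \<in> carrier_vec m"
    and eq: "equivalent G p q"
  shows "(\<Sum>k<m. quad_form n s (\<lambda>i. q i $ k)) = (\<Sum>k<r. quad_form n s (\<lambda>i. p i $ k))"
proof -
  interpret pair_graph G by fact
  have sym: "s i j = s j i" if "i \<in> {..<n}" "j \<in> {..<n}" for i j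
    using stress_functionD(1)[OF s] that by auto
  have rows: "(\<Sum>j<n. s i j) = 0" if "i \<in> {..<n}" for i
    using stress_functionD(3)[OF s, of i r] that by (simp add: homog_def)
  have energy: "(\<Sum>k<d. quad_form n s (\<lambda>i. f i $ k)) =
      - (\<Sum>i<n. \<Sum>j<n. s i j * (\<Sum>k<d. (f i $ k - f j $ k)\<^sup>2)) / 2" for f d
  proof -
    have one: "quad_form n s (\<lambda>i. f i $ k) = - (\<Sum>i<n. \<Sum>j<n. s i j * (f i $ k - f j $ k)\<^sup>2) / 2" for k
      unfolding quad_form_def by (rule quadratic_form_zero_row_sums[OF sym rows])
    have "(\<Sum>k<d. quad_form n s (\<lambda>i. f i $ k)) =
        - (\<Sum>k<d. \<Sum>i<n. \<Sum>j<n. s i j * (f i $ k - f j $ k)\<^sup>2) / 2"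
      unfolding one by (simp add: sum_negf sum_divide_distrib)
    also have "(\<Sum>k<d. \<Sum>i<n. \<Sum>j<n. s i j * (f i $ k - f j $ k)\<^sup>2) =
        (\<Sum>i<n. \<Sum>k<d. \<Sum>j<n. s i j * (f i $ k - f j $ k)\<^sup>2)" by (rule sum.swap)
    also have "\<dots> = (\<Sum>i<n. \<Sum>j<n. \<Sum>k<d. s i j * (f i $ k - f j $ k)\<^sup>2)"
      by (intro sum.cong refl sum.swap)
    finally show ?thesis by (simp add: sum_distrib_left)
  qed
  have "s i j * (\<Sum>k<m. (q i $ k - q j $ k)\<^sup>2) = s i j * (\<Sum>k<r. (p i $ k - p j $ k)\<^sup>2)"
    if ij: "i < n" "j < n" for i j
  proof (cases "(i, j) \<in> parcs G")
    case True
    then have "edist (q i) (q j) = edist (p i) (p j)" using eq by (auto simp: equivalent_def)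
    then show ?thesis
      using edist_coordinates[OF q[OF ij(1)] q[OF ij(2)]] edist_coordinates[OF p[OF ij(1)] p[OF ij(2)]]
      by simp
  next
    case False
    then have "i \<noteq> j \<Longrightarrow> s i j = 0" using stress_functionD(2)[OF s ij] by simp
    then show ?thesis by (cases "i = j") simp_all
  qed
  then have "(\<Sum>i<n. \<Sum>j<n. s i j * (\<Sum>k<m. (q i $ k - q j $ k)\<^sup>2)) =
      (\<Sum>i<n. \<Sum>j<n. s i j * (\<Sum>k<r. (p i $ k - p j $ k)\<^sup>2))"
    by (intro sum.cong refl) simp
  then show ?thesis unfolding energy by simp
qed

text \<open>
  The energy of \<open>p\<close> is zero, hence so is that of \<open>q\<close>. It is the sum of the values of a
  nonnegative form at the coordinate vectors of \<open>q\<close>, so each of these values is zero.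
\<close>
lemma equivalent_in_kernel_of_psd_stress:
  assumes G: "pair_graph G" "pverts G = {..<n}" and s: "stress_function n r G p s"
    and psd: "\<And>x. quad_form n s x \<ge> 0"
    and p: "\<And>i. i < n \<Longrightarrow> p i \<in> carrier_vec r" and q: "\<And>i. i < n \<Longrightarrow> q i \<in> carrier_vec m"
    and eq: "equivalent G p q" and k: "k < m" and a: "a < n"
  shows "(\<Sum>j<n. s a j * q j $ k) = 0"
proof (rule kernel_if_quad_form_zero[OF _ psd _ a])
  show "s i j = s j i" if "i < n" "j < n" for i j
    using stress_functionD(1)[OF s] that by auto
  have "quad_form n s (\<lambda>i. p i $ k) = 0" if "k < r" for k
  proof -
    have "(\<Sum>j<n. s i j * p j $ k) = 0" if "i < n" for i
      using stress_functionD(3)[OF s that, of k] \<open>k < r\<close> by (simp add: homog_def)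
    then show ?thesis by (simp add: quad_form_def)
  qed
  then have "(\<Sum>k<m. quad_form n s (\<lambda>i. q i $ k)) = 0"
    using stress_energy_eq_if_equivalent[OF G s p q eq] by simp
  then show "quad_form n s (\<lambda>i. q i $ k) = 0"
    using psd k by (subst (asm) sum_nonneg_eq_0_iff) auto
qed

text \<open>
  The squared length of \<open>\<Sum>i\<in>I. c i x i\<close> with \<open>\<Sum>i\<in>I. c i = 0\<close> depends only on the mutual distances of
  the points \<open>x i\<close>.
\<close>
lemma affine_combination_sqdist:
  fixes x :: "'i \<Rightarrow> nat \<Rightarrow> real"
  assumes "(\<Sum>i\<in>I. c i) = 0"
  shows "(\<Sum>k<m. (\<Sum>i\<in>I. c i * x i k)\<^sup>2) =
    - (\<Sum>i\<in>I. \<Sum>j\<in>I. c i * c j * (\<Sum>k<m. (x i k - x j k)\<^sup>2)) / 2"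
proof -
  have one: "(\<Sum>i\<in>I. c i * x i k)\<^sup>2 = - (\<Sum>i\<in>I. \<Sum>j\<in>I. c i * c j * (x i k - x j k)\<^sup>2) / 2" for k
  proof -
    have "(\<Sum>i\<in>I. c i * x i k)\<^sup>2 = (\<Sum>i\<in>I. x i k * (\<Sum>j\<in>I. c i * c j * x j k))"
      by (simp add: power2_eq_square sum_distrib_right sum_distrib_left mult_ac)
    also have "\<dots> = - (\<Sum>i\<in>I. \<Sum>j\<in>I. c i * c j * (x i k - x j k)\<^sup>2) / 2"
      using assms by (intro quadratic_form_zero_row_sums) (simp_all add: sum_distrib_left[symmetric])
    finally show ?thesis .
  qed
  have "(\<Sum>k<m. (\<Sum>i\<in>I. c i * x i k)\<^sup>2) =
      - (\<Sum>k<m. \<Sum>i\<in>I. \<Sum>j\<in>I. c i * c j * (x i k - x j k)\<^sup>2) / 2"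
    unfolding one by (simp add: sum_negf sum_divide_distrib)
  also have "(\<Sum>k<m. \<Sum>i\<in>I. \<Sum>j\<in>I. c i * c j * (x i k - x j k)\<^sup>2) =
      (\<Sum>i\<in>I. \<Sum>k<m. \<Sum>j\<in>I. c i * c j * (x i k - x j k)\<^sup>2)" by (rule sum.swap)
  also have "\<dots> = (\<Sum>i\<in>I. \<Sum>j\<in>I. \<Sum>k<m. c i * c j * (x i k - x j k)\<^sup>2)"
    by (intro sum.cong refl sum.swap)
  finally show ?thesis by (simp add: sum_distrib_left)
qed

text \<open>
  Both \<open>q a - q b\<close> and \<open>p a - p b\<close> are the combination of the points of \<open>K\<close> with the
  same coefficients \<open>\<mu> i (p a) - \<mu> i (p b)\<close>, of sum zero, and the distances inside the clique \<open>K\<close>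
  agree. The clique replaces the usual condition that no conic at infinity contains the edge
  directions.
\<close>
lemma universally_rigid_if_psd_stress_and_clique:
  assumes fw: "bar_framework n r G p" and gp: "general_position n r p"
    and s: "stress_function n r G p s" and psd: "\<And>x. quad_form n s x \<ge> 0"
    and rank: "vec_space.rank n (mat n n (\<lambda>(i, j). s i j)) = n - r - 1"
    and K: "K \<subseteq> {..<n}" "card K = Suc r" "clique (parcs G) K"
  shows "universally_rigid n G p"
  unfolding universally_rigid_def congruent_def
proof (intro allI impI)
  fix m q a b
  assume q': "bar_framework n m G q \<and> equivalent G p q" and ab: "a < n" "b < n"
  then have q: "\<And>i. i < n \<Longrightarrow> q i \<in> carrier_vec m" and eq: "equivalent G p q"
    by (auto simp: bar_framework_def)
  have G: "pair_graph G" "pverts G = {..<n}" and p: "\<And>i. i < n \<Longrightarrow> p i \<in> carrier_vec r"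
    using fw by (auto simp: bar_framework_def)
  have eqK: "(\<Sum>k<m. (q i $ k - q j $ k)\<^sup>2) = (\<Sum>k<r. (p i $ k - p j $ k)\<^sup>2)"
    if ij: "i \<in> K" "j \<in> K" for i j
  proof (cases "i = j")
    case False
    then have "(i, j) \<in> parcs G" using K(3) ij by (auto simp: clique_def)
    then have "edist (q i) (q j) = edist (p i) (p j)" using eq by (auto simp: equivalent_def)
    moreover have "i < n" "j < n" using ij K(1) by auto
    ultimately show ?thesis
      using edist_coordinates[OF q q, of i j] edist_coordinates[OF p p, of i j] by simp
  qed simp
  obtain \<beta> \<mu> where \<mu>: "\<And>i x. \<mu> i x = (\<Sum>k\<le>r. \<beta> i k * homog r x k)"
    and dual: "\<And>i j. i \<in> K \<Longrightarrow> j \<in> K \<Longrightarrow> \<mu> i (p j) = (if i = j then 1 else 0)"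
    and bary: "\<And>x k. k \<le> r \<Longrightarrow> (\<Sum>i\<in>K. \<mu> i x * homog r (p i) k) = homog r x k"
    by (rule barycentric_coordinates[OF gp p K(1,2)]) blast+
  have exq: "q j $ k = (\<Sum>i\<in>K. \<mu> i (p j) * q i $ k)" if "k < m" "j < n" for j k
    by (rule kernel_vector_extrapolation[OF gp p K(1,2) s rank \<mu> dual])
      (use that equivalent_in_kernel_of_psd_stress[OF G s psd p q eq] in auto)
  have exp: "p j $ k = (\<Sum>i\<in>K. \<mu> i (p j) * p i $ k)" if "k < r" "j < n" for j k
    using bary[of k "p j"] that by (simp add: homog_def)
  define c where "c i = \<mu> i (p a) - \<mu> i (p b)" for i
  have c0: "(\<Sum>i\<in>K. c i) = 0"
    using bary[of r "p a"] bary[of r "p b"] by (simp add: c_def sum_subtractf homog_def)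
  have "(\<Sum>k<m. (q a $ k - q b $ k)\<^sup>2) = (\<Sum>k<m. (\<Sum>i\<in>K. c i * q i $ k)\<^sup>2)"
    using exq[OF _ ab(1)] exq[OF _ ab(2)]
    by (intro sum.cong refl) (simp add: c_def left_diff_distrib sum_subtractf)
  also have "\<dots> = (\<Sum>k<r. (\<Sum>i\<in>K. c i * p i $ k)\<^sup>2)"
    unfolding affine_combination_sqdist[OF c0] using eqK by simp
  also have "\<dots> = (\<Sum>k<r. (p a $ k - p b $ k)\<^sup>2)"
    using exp[OF _ ab(1)] exp[OF _ ab(2)]
    by (intro sum.cong refl) (simp add: c_def left_diff_distrib sum_subtractf)
  finally show "edist (q a) (q b) = edist (p a) (p b)"
    using edist_coordinates[OF q q, OF ab] edist_coordinates[OF p p, OF ab] by simp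
qed

section \<open>Stresses of chordal graphs\<close>

text \<open>
  The invariant of the construction: a positive semidefinite stress of the subframework on \<open>W\<close>,
  extended by zero, with as small a kernel as possible. The last clause is the rank
  condition in the form of \<open>stress_rank_iff\<close>; it survives the addition of a vertex,
  while \<open>I\<close> stays fixed.
\<close>
definition super_stable_on ::
  "nat \<Rightarrow> nat \<Rightarrow> nat pair_pre_digraph \<Rightarrow> (nat \<Rightarrow> real vec) \<Rightarrow> nat set \<Rightarrow> nat set \<Rightarrow>
    (nat \<Rightarrow> nat \<Rightarrow> real) \<Rightarrow> bool" where
  "super_stable_on n r G p W I s \<longleftrightarrow> I \<subseteq> W \<and> card I = Suc r \<and> (\<forall>i j. s i j = s j i) \<and>
    (\<forall>i j. s i j \<noteq> 0 \<longrightarrow> i \<in> W \<and> j \<in> W \<and> (i = j \<or> (i, j) \<in> parcs G)) \<and>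
    (\<forall>i. \<forall>k\<le>r. (\<Sum>j<n. s i j * homog r (p j) k) = 0) \<and>
    (\<forall>x. quad_form n s x \<ge> 0) \<and>
    (\<forall>x. quad_form n s x = 0 \<and> (\<forall>i\<in>I. x i = 0) \<longrightarrow> (\<forall>i\<in>W. x i = 0))"

text \<open>
  On \<open>r + 1\<close> vertices the zero stress will do. In the step, let \<open>a\<close> be the affine dependency of
  the clique \<open>K \<union> {v}\<close>, normalized by \<open>a v = 1\<close>, and add \<open>a a\<^sup>T\<close>. The form then grows by the
  square of \<open>\<Sum>j. a j * x j\<close>; where it vanishes, \<open>x\<close> vanishes on \<open>W - {v}\<close> by
  induction, and the square forces \<open>x v = 0\<close>.
\<close>
lemma chordal_imp_super_stable:
  assumes G: "pair_graph G" "pverts G = {..<n}" "chordal G" and gp: "general_position n r p"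
    and p: "\<And>i. i < n \<Longrightarrow> p i \<in> carrier_vec r"
    and W: "W \<subseteq> {..<n}" "r < card W" "separation_free r (parcs G) W"
  shows "\<exists>s I. super_stable_on n r G p W I s"
  using W
proof (induction "card W" arbitrary: W rule: less_induct)
  case less
  have finW: "finite W" using less.prems(1) finite_subset by blast
  show ?case
  proof (cases "card W = Suc r")
    case True
    then show ?thesis
      by (intro exI[of _ "\<lambda>_ _. 0"] exI[of _ W]) (simp add: super_stable_on_def quad_form_def)
  next
    case False
    then have card: "card W \<ge> r + 2" using less.prems(2) by simp
    obtain v K where v: "v \<in> W" and K: "K \<subseteq> W - {v}" "card K = r + 1"
      "clique (parcs G) (insert v K)" and sf: "separation_free r (parcs G) (W - {v})"
      using chordal_peel_vertex[OF G(1,3) finW card less.prems(3)] .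
    have smaller: "card (W - {v}) < card W" "W - {v} \<subseteq> {..<n}" "r < card (W - {v})"
      using v finW card less.prems(1) by auto
    obtain s I where IH: "super_stable_on n r G p (W - {v}) I s"
      using less.hyps[OF smaller sf] by blast
    have I: "I \<subseteq> W - {v}" "card I = Suc r"
      and sym: "\<And>i j. s i j = s j i"
      and supp: "\<And>i j. s i j \<noteq> 0 \<Longrightarrow> i \<in> W - {v} \<and> j \<in> W - {v} \<and> (i = j \<or> (i, j) \<in> parcs G)"
      and ker: "\<And>i k. k \<le> r \<Longrightarrow> (\<Sum>j<n. s i j * homog r (p j) k) = 0"
      and psd: "\<And>x. quad_form n s x \<ge> 0"
      and det: "\<And>x. quad_form n s x = 0 \<Longrightarrow> \<forall>i\<in>I. x i = 0 \<Longrightarrow> \<forall>i\<in>W - {v}. x i = 0"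
      using IH unfolding super_stable_on_def by blast+
    have Kn: "K \<subseteq> {..<n}" "v < n" "v \<notin> K" "card K = Suc r"
      using K(1,2) v less.prems(1) by auto
    obtain \<beta> \<mu> where bary: "\<And>x k. k \<le> r \<Longrightarrow> (\<Sum>i\<in>K. \<mu> i x * homog r (p i) k) = homog r x k"
      using barycentric_coordinates[OF gp p Kn(1) Kn(4)] by metis
    define a where "a j = (if j = v then 1 else if j \<in> K then - \<mu> j (p v) else 0)" for j
    define s' where "s' i j = s i j + a i * a j" for i j
    have a0: "(\<Sum>j<n. a j * homog r (p j) k) = 0" if "k \<le> r" for k
    proof -
      have "(\<Sum>j<n. a j * homog r (p j) k) = (\<Sum>j\<in>insert v K. a j * homog r (p j) k)"
        using Kn by (intro sum.mono_neutral_right) (auto simp: a_def)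
      also have "\<dots> = homog r (p v) k + (\<Sum>j\<in>K. a j * homog r (p j) k)"
        using Kn finite_subset[OF Kn(1)] by (simp add: a_def)
      also have "(\<Sum>j\<in>K. a j * homog r (p j) k) = - (\<Sum>j\<in>K. \<mu> j (p v) * homog r (p j) k)"
        unfolding sum_negf[symmetric] using Kn by (intro sum.cong) (auto simp: a_def)
      finally show ?thesis using bary[OF that] by simp
    qed
    have quad: "quad_form n s' x = quad_form n s x + (\<Sum>j<n. a j * x j)\<^sup>2" for x
    proof -
      have "(\<Sum>j<n. s' i j * x j) = (\<Sum>j<n. s i j * x j) + a i * (\<Sum>j<n. a j * x j)" for i
        by (simp add: s'_def distrib_right sum.distrib sum_distrib_left mult.assoc)
      then have "quad_form n s' x =
          (\<Sum>i<n. x i * (\<Sum>j<n. s i j * x j) + (a i * x i) * (\<Sum>j<n. a j * x j))"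
        unfolding quad_form_def by (simp add: distrib_left mult_ac)
      then show ?thesis
        by (simp add: quad_form_def sum.distrib sum_distrib_right power2_eq_square)
    qed
    have anz: "i \<in> insert v K" if "a i \<noteq> 0" for i using that by (auto simp: a_def split: if_splits)
    have supp': "i \<in> W \<and> j \<in> W \<and> (i = j \<or> (i, j) \<in> parcs G)" if "s' i j \<noteq> 0" for i j
    proof (cases "s i j = 0")
      case True
      then have "i \<in> insert v K" "j \<in> insert v K" using that anz by (auto simp: s'_def)
      then show ?thesis using K(1,3) v unfolding clique_def by blast
    next
      case False
      then show ?thesis using supp[of i j] by blast
    qed
    have ker': "(\<Sum>j<n. s' i j * homog r (p j) k) = 0" if "k \<le> r" for i k
    proof -
      have "(\<Sum>j<n. s' i j * homog r (p j) k) =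
          (\<Sum>j<n. s i j * homog r (p j) k) + a i * (\<Sum>j<n. a j * homog r (p j) k)"
        by (simp add: s'_def distrib_right sum.distrib sum_distrib_left mult.assoc)
      then show ?thesis using ker[OF that] a0[OF that] by simp
    qed
    have det': "\<forall>i\<in>W. x i = 0" if x: "quad_form n s' x = 0" "\<forall>i\<in>I. x i = 0" for x
    proof -
      have "quad_form n s x = 0" and ax: "(\<Sum>j<n. a j * x j) = 0"
        using x(1) psd[of x] unfolding quad by (simp_all add: add_nonneg_eq_0_iff)
      then have rest: "\<forall>i\<in>W - {v}. x i = 0" using det x(2) by blast
      have "(\<Sum>j<n. a j * x j) = (\<Sum>j\<in>{v}. a j * x j)"
        using Kn rest K(1) by (intro sum.mono_neutral_right) (auto simp: a_def)
      then have "x v = 0" using ax by (simp add: a_def)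
      then show ?thesis using rest by blast
    qed
    have "super_stable_on n r G p W I s'"
      unfolding super_stable_on_def
    proof (intro conjI allI impI)
      show "s' i j = s' j i" for i j using sym[of i j] by (simp add: s'_def mult.commute)
      show "quad_form n s' x \<ge> 0" for x using psd[of x] by (simp add: quad)
      show "\<forall>i\<in>W. x i = 0" if "quad_form n s' x = 0 \<and> (\<forall>i\<in>I. x i = 0)" for x
        using det' that by blast
    qed (use I supp' ker' in blast)+
    then show ?thesis by blast
  qed
qed

section \<open>Reflection of one side of a separation\<close>

text \<open>
  Reflect the side \<open>B\<close> of a separation \<open>A, X, B\<close> in the hyperplane spanned by the \<open>r\<close> points of \<open>X\<close>.
  The hyperplane is the zero set of \<open>f\<close>, the barycentric coordinate of \<open>a \<in> A\<close> with respect to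
  \<open>X \<union> {a}\<close>. Reflecting one of two points \<open>x\<close>, \<open>y\<close> changes their squared distance
  by \<open>4 f(x) f(y) / N\<close>, where \<open>N\<close> is the squared length of the normal vector. This is zero if one of them is in \<open>X\<close>, but
  not for \<open>a\<close> and \<open>b \<in> B\<close>, because by general position \<open>f\<close> has no zeros among the points
  outside \<open>X\<close>.
\<close>
lemma not_separation_free_imp_flip:
  assumes fw: "bar_framework n r G p" and gp: "general_position n r p" and r: "r \<ge> 1"
    and sep: "\<not> separation_free r (parcs G) {..<n}"
  obtains q I a b where "bar_framework n r G q" "equivalent G p q"
    "I \<subseteq> {..<n}" "card I = Suc r" "\<And>i. i \<in> I \<Longrightarrow> q i = p i"
    "a < n" "b < n" "edist (q a) (q b) \<noteq> edist (p a) (p b)"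
proof -
  have G: "pair_graph G" "pverts G = {..<n}" and p: "\<And>i. i < n \<Longrightarrow> p i \<in> carrier_vec r"
    using fw by (auto simp: bar_framework_def)
  interpret pair_graph G by fact
  obtain X A where X: "X \<subseteq> {..<n}" "card X = r" and A: "A \<subseteq> {..<n} - X" "A \<noteq> {}" "A \<noteq> {..<n} - X"
    and no: "\<And>x y. x \<in> A \<Longrightarrow> y \<in> {..<n} - X - A \<Longrightarrow> (x, y) \<notin> parcs G"
    using sep unfolding separation_free_def connected_on_def by blast
  define B where "B = {..<n} - X - A"
  obtain a b where a: "a \<in> A" and b: "b \<in> B" using A unfolding B_def by blast
  have fin: "finite X" using X(1) finite_subset by blast
  have ab: "a < n" "b < n" "a \<notin> X" "b \<notin> X" "a \<notin> B" "a \<noteq> b" using a b A(1) by (auto simp: B_def)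
  define I where "I = insert a X"
  have I: "I \<subseteq> {..<n}" "card I = Suc r" using X ab fin by (auto simp: I_def)
  obtain \<beta> \<mu> where \<mu>: "\<And>i x. \<mu> i x = (\<Sum>k\<le>r. \<beta> i k * homog r x k)"
    and dual: "\<And>i j. i \<in> I \<Longrightarrow> j \<in> I \<Longrightarrow> \<mu> i (p j) = (if i = j then 1 else 0)"
    and bary: "\<And>x k. k \<le> r \<Longrightarrow> (\<Sum>i\<in>I. \<mu> i x * homog r (p i) k) = homog r x k"
    by (rule barycentric_coordinates[OF gp p I]) blast+
  define \<alpha> where "\<alpha> = \<beta> a"
  define f where "f = \<mu> a"
  have fX: "f (p i) = 0" if "i \<in> X" for i using dual[of a i] that ab by (auto simp: f_def I_def)
  have fa: "f (p a) = 1" using dual[of a a] by (simp add: f_def I_def)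
  have fb: "f (p b) \<noteq> 0"
  proof
    assume fb: "f (p b) = 0"
    \<comment> \<open>Then \<open>p b\<close> would be an affine combination of the points of \<open>X\<close> alone.\<close>
    define c where "c i = (if i = b then 1 else - \<mu> i (p b))" for i
    have J: "insert b X \<subseteq> {..<n}" "card (insert b X) = Suc r" using X ab fin by auto
    have "(\<Sum>i\<in>insert b X. c i * homog r (p i) k) = 0" if k: "k \<le> r" for k
    proof -
      have "(\<Sum>i\<in>X. c i * homog r (p i) k) = - (\<Sum>i\<in>X. \<mu> i (p b) * homog r (p i) k)"
        unfolding sum_negf[symmetric] using ab by (intro sum.cong) (auto simp: c_def)
      moreover have "(\<Sum>i\<in>X. \<mu> i (p b) * homog r (p i) k) = homog r (p b) k"
        using bary[OF k, of "p b"] fb fin ab by (simp add: I_def f_def)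
      ultimately show ?thesis using fin ab by (simp add: c_def)
    qed
    from general_position_homog_independent[OF gp p J this] show False by (simp add: c_def)
  qed
  \<comment> \<open>The first \<open>r\<close> coefficients of \<open>f\<close> form a normal vector of the hyperplane; \<open>N\<close> is its squared length.\<close>
  define N where "N = (\<Sum>k<r. (\<alpha> k)\<^sup>2)"
  have fdiff: "(\<Sum>k<r. \<alpha> k * (x $ k - y $ k)) = f x - f y" for x y
    unfolding f_def \<mu> \<alpha>_def lessThan_Suc_atMost[symmetric]
    by (simp add: homog_def right_diff_distrib sum_subtractf)
  have N: "N \<noteq> 0"
  proof
    assume "N = 0"
    then have "\<alpha> k = 0" if "k < r" for k
      using that by (simp add: N_def sum_nonneg_eq_0_iff)
    then have "f (p a) - f x = 0" for x unfolding fdiff[symmetric] by simp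
    \<comment> \<open>Here \<open>r \<ge> 1\<close> matters: \<open>f\<close> takes the value 1 at \<open>p a\<close> and 0 on \<open>X\<close>, so it is not constant.\<close>
    moreover obtain x where "x \<in> X" using X(2) r by fastforce
    ultimately show False using fX fa by (metis diff_0_right zero_neq_one)
  qed
  have expand: "(\<Sum>k<r. (d k + t * \<alpha> k)\<^sup>2) = (\<Sum>k<r. (d k)\<^sup>2) + 2 * t * (\<Sum>k<r. \<alpha> k * d k) + t\<^sup>2 * N"
    for d t unfolding N_def sum_distrib_left sum.distrib[symmetric]
    by (intro sum.cong refl) (simp add: power2_eq_square algebra_simps)
  define \<sigma> where "\<sigma> x = vec r (\<lambda>k. x $ k - 2 * f x / N * \<alpha> k)" for x :: "real vec"
  have \<sigma>: "\<sigma> x \<in> carrier_vec r" for x by (simp add: \<sigma>_def)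
  have one: "(\<Sum>k<r. (x $ k - \<sigma> y $ k)\<^sup>2) = (\<Sum>k<r. (x $ k - y $ k)\<^sup>2) + 4 * f x * f y / N" for x y
  proof -
    have "(\<Sum>k<r. (x $ k - \<sigma> y $ k)\<^sup>2) = (\<Sum>k<r. ((x $ k - y $ k) + (2 * f y / N) * \<alpha> k)\<^sup>2)"
      by (intro sum.cong refl) (simp add: \<sigma>_def algebra_simps)
    also have "\<dots> = (\<Sum>k<r. (x $ k - y $ k)\<^sup>2) + 2 * (2 * f y / N) * (f x - f y) + (2 * f y / N)\<^sup>2 * N"
      unfolding expand fdiff ..
    finally show ?thesis using N by (simp add: power2_eq_square field_simps)
  qed
  have both: "(\<Sum>k<r. (\<sigma> x $ k - \<sigma> y $ k)\<^sup>2) = (\<Sum>k<r. (x $ k - y $ k)\<^sup>2)" for x y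
  proof -
    have "(\<Sum>k<r. (\<sigma> x $ k - \<sigma> y $ k)\<^sup>2) =
        (\<Sum>k<r. ((x $ k - y $ k) + (- 2 * (f x - f y) / N) * \<alpha> k)\<^sup>2)"
      by (intro sum.cong refl) (simp add: \<sigma>_def diff_divide_distrib algebra_simps)
    also have "\<dots> = (\<Sum>k<r. (x $ k - y $ k)\<^sup>2) + 2 * (- 2 * (f x - f y) / N) * (f x - f y)
        + (- 2 * (f x - f y) / N)\<^sup>2 * N"
      unfolding expand fdiff ..
    finally show ?thesis using N by (simp add: power2_eq_square field_simps)
  qed
  define q where "q i = (if i \<in> B then \<sigma> (p i) else p i)" for i
  have q: "q i \<in> carrier_vec r" if "i < n" for i using p[OF that] \<sigma> by (simp add: q_def)
  have qI: "q i = p i" if "i \<in> I" for i using that a by (auto simp: q_def I_def B_def)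
  have "affinely_spans n r q" by (rule affinely_spans_if_agrees_on_simplex[OF gp p I q qI])
  then have fwq: "bar_framework n r G q" using fw q by (simp add: bar_framework_def)
  have mixed: "(\<Sum>k<r. (q i $ k - q j $ k)\<^sup>2) = (\<Sum>k<r. (p i $ k - p j $ k)\<^sup>2)"
    if "(i, j) \<in> parcs G" "i \<notin> B" "j \<in> B" for i j
  proof -
    have "i < n" using in_arcsD1[OF that(1)] G(2) by auto
    then have "i \<in> X" using that no[of i j] by (auto simp: B_def)
    then show ?thesis using that one[of "p i" "p j"] fX by (simp add: q_def)
  qed
  have sqd: "(\<Sum>k<r. (q i $ k - q j $ k)\<^sup>2) = (\<Sum>k<r. (p i $ k - p j $ k)\<^sup>2)"
    if "(i, j) \<in> parcs G" for i j
  proof -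
    consider "i \<in> B" "j \<in> B" | "i \<notin> B" "j \<in> B" | "i \<in> B" "j \<notin> B" | "i \<notin> B" "j \<notin> B" by blast
    then show ?thesis
    proof cases
      case 1 then show ?thesis using both by (simp add: q_def)
    next
      case 2 then show ?thesis using mixed that by blast
    next
      case 3
      then show ?thesis
        using mixed[OF arcs_symmetric[OF that]] by (simp add: power2_commute)
    next
      case 4 then show ?thesis by (simp add: q_def)
    qed
  qed
  have "equivalent G p q"
    unfolding equivalent_def
  proof (safe)
    fix i j assume ij: "(i, j) \<in> parcs G"
    then have "i < n" "j < n" using in_arcsD1[OF ij] in_arcsD2[OF ij] G(2) by auto
    then show "edist (q i) (q j) = edist (p i) (p j)"
      using edist_coordinates[OF q q, of i j] edist_coordinates[OF p p, of i j] sqd[OF ij] by simp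
  qed
  moreover have "edist (q a) (q b) \<noteq> edist (p a) (p b)"
  proof -
    have "(\<Sum>k<r. (q a $ k - q b $ k)\<^sup>2) \<noteq> (\<Sum>k<r. (p a $ k - p b $ k)\<^sup>2)"
      using one[of "p a" "p b"] fa fb N ab b by (simp add: q_def)
    then show ?thesis
      using edist_coordinates[OF q q, OF ab(1,2)] edist_coordinates[OF p p, OF ab(1,2)] by simp
  qed
  ultimately show ?thesis using that[OF fwq _ I qI ab(1,2)] by blast
qed

section \<open>The equivalence\<close>

theorem theorem1p3:
  fixes r n :: nat and G :: "nat pair_pre_digraph" and p :: "nat \<Rightarrow> real vec"
  assumes "r \<ge> 1" and "n \<ge> r + 2"
    and "bar_framework n r G p"
    and "chordal G"
    and "general_position n r p"
  shows "(vertex_connected (r + 1) G \<longleftrightarrow>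
           (\<exists>S. stress_matrix n r G p S \<and> positive_semidefinite n S \<and>
                vec_space.rank n S = n - r - 1))
       \<and> ((\<exists>S. stress_matrix n r G p S \<and> positive_semidefinite n S \<and>
                vec_space.rank n S = n - r - 1) \<longleftrightarrow> universally_rigid n G p)
       \<and> (universally_rigid n G p \<longleftrightarrow> globally_rigid n r G p)"
proof -
  note fw = \<open>bar_framework n r G p\<close> and gp = \<open>general_position n r p\<close>
  have G: "pair_graph G" "pverts G = {..<n}" and p: "\<And>i. i < n \<Longrightarrow> p i \<in> carrier_vec r"
    using fw by (auto simp: bar_framework_def)
  define sf where "sf \<longleftrightarrow> separation_free r (parcs G) {..<n}"
  define stressed where "stressed \<longleftrightarrow> (\<exists>s. stress_function n r G p s \<and> (\<forall>x. quad_form n s x \<ge> 0) \<and>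
    vec_space.rank n (mat n n (\<lambda>(i, j). s i j)) = n - r - 1)"
  have conn: "vertex_connected (r + 1) G \<longleftrightarrow> sf"
    using vertex_connected_iff_separation_free[OF G(1), of r] \<open>n \<ge> r + 2\<close> by (simp add: G(2) sf_def)
  have sm_iff: "stress_matrix n r G p S \<longleftrightarrow>
      (\<exists>s. stress_function n r G p s \<and> S = mat n n (\<lambda>(i, j). s i j))" for S
    by (rule stress_matrix_iff[OF G p])
  have psd_iff: "positive_semidefinite n (mat n n (\<lambda>(i, j). s i j)) \<longleftrightarrow> (\<forall>x. quad_form n s x \<ge> 0)"
    if "stress_function n r G p s" for s
    using stress_functionD(1)[OF that] unfolding positive_semidefinite_mat_iff by blast
  have stress: "(\<exists>S. stress_matrix n r G p S \<and> positive_semidefinite n S \<and>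
      vec_space.rank n S = n - r - 1) \<longleftrightarrow> stressed"
    (is "?L \<longleftrightarrow> _")
  proof
    assume ?L
    then obtain S where S: "stress_matrix n r G p S" "positive_semidefinite n S"
      "vec_space.rank n S = n - r - 1" by (elim exE conjE)
    obtain s where s: "stress_function n r G p s" and eq: "S = mat n n (\<lambda>(i, j). s i j)"
      using iffD1[OF sm_iff S(1)] by (elim exE conjE)
    show stressed
      unfolding stressed_def
      using s psd_iff[OF s] S(2,3) unfolding eq by (intro exI[of _ s] conjI) simp_all
  next
    assume stressed
    then obtain s where s: "stress_function n r G p s" "\<forall>x. quad_form n s x \<ge> 0"
      "vec_space.rank n (mat n n (\<lambda>(i, j). s i j)) = n - r - 1"
      unfolding stressed_def by (elim exE conjE)
    have "stress_matrix n r G p (mat n n (\<lambda>(i, j). s i j))"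
      using s(1) by (intro iffD2[OF sm_iff] exI[of _ s]) simp_all
    then show ?L using s psd_iff[OF s(1)] by (intro exI conjI) simp_all
  qed
  have 12: stressed if sf
  proof -
    have "\<exists>s I. super_stable_on n r G p {..<n} I s"
      using that \<open>n \<ge> r + 2\<close>
      by (intro chordal_imp_super_stable[OF G \<open>chordal G\<close> gp p]) (auto simp: sf_def)
    then obtain s I where H: "super_stable_on n r G p {..<n} I s" by blast
    have I: "I \<subseteq> {..<n}" "card I = Suc r" and psd: "\<forall>x. quad_form n s x \<ge> 0"
      and det: "\<And>x. quad_form n s x = 0 \<Longrightarrow> \<forall>i\<in>I. x i = 0 \<Longrightarrow> \<forall>i\<in>{..<n}. x i = 0"
      and s: "stress_function n r G p s"
      using H unfolding super_stable_on_def stress_function_def by blast+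
    have "\<forall>i<n. x i = 0" if "\<forall>a<n. (\<Sum>j<n. s a j * x j) = 0" "\<forall>i\<in>I. x i = 0" for x
      using det[OF _ that(2)] that(1) by (simp add: quad_form_def)
    then have "vec_space.rank n (mat n n (\<lambda>(i, j). s i j)) = n - r - 1"
      using stress_rank_iff[OF gp p I s] by blast
    then show stressed using s psd unfolding stressed_def by blast
  qed
  have 23: "universally_rigid n G p" if con: sf
  proof -
    obtain s where s: "stress_function n r G p s" "\<And>x. quad_form n s x \<ge> 0"
      "vec_space.rank n (mat n n (\<lambda>(i, j). s i j)) = n - r - 1"
      using 12[OF con] unfolding stressed_def by blast
    obtain v K where "K \<subseteq> {..<n} - {v}" "card K = r + 1" "clique (parcs G) (insert v K)"
      using chordal_peel_vertex[OF G(1) \<open>chordal G\<close>, of "{..<n}" r] con \<open>n \<ge> r + 2\<close>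
      unfolding sf_def by (metis card_lessThan finite_lessThan)
    then show ?thesis
      by (intro universally_rigid_if_psd_stress_and_clique[OF fw gp s, of K]) (auto simp: clique_def)
  qed
  have 34: "globally_rigid n r G p" if "universally_rigid n G p"
    using that by (auto simp: universally_rigid_def globally_rigid_def)
  have 41: sf if "globally_rigid n r G p"
  proof (rule ccontr)
    assume "\<not> sf"
    then show False
      using not_separation_free_imp_flip[OF fw gp \<open>r \<ge> 1\<close>] that
      unfolding sf_def globally_rigid_def congruent_def by metis
  qed
  have 21: sf if str: stressed
  proof (rule ccontr)
    assume "\<not> sf"
    then obtain q I a b where q: "bar_framework n r G q" "equivalent G p q"
      and I: "I \<subseteq> {..<n}" "card I = Suc r" "\<And>i. i \<in> I \<Longrightarrow> q i = p i"
      and ab: "a < n" "b < n" "edist (q a) (q b) \<noteq> edist (p a) (p b)"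
      using not_separation_free_imp_flip[OF fw gp \<open>r \<ge> 1\<close>] unfolding sf_def by metis
    obtain s where s: "stress_function n r G p s" and psd: "\<And>x. quad_form n s x \<ge> 0"
      and rank: "vec_space.rank n (mat n n (\<lambda>(i, j). s i j)) = n - r - 1"
      using str unfolding stressed_def by blast
    have qc: "\<And>i. i < n \<Longrightarrow> q i \<in> carrier_vec r" using q by (simp add: bar_framework_def)
    have "q i $ k = p i $ k" if k: "k < r" and i: "i < n" for i k
    proof -
      have "(\<Sum>j<n. s a j * (q j $ k - p j $ k)) = 0" if "a < n" for a
        using equivalent_in_kernel_of_psd_stress[OF G s psd p qc q(2) k that]
          stress_functionD(3)[OF s that, of k] k
        by (simp add: right_diff_distrib sum_subtractf homog_def)
      then have "(\<forall>a<n. (\<Sum>j<n. s a j * (q j $ k - p j $ k)) = 0) \<and>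
          (\<forall>i\<in>I. q i $ k - p i $ k = 0)" using I(3) by simp
      from mp[OF spec[OF iffD1[OF stress_rank_iff[OF gp p I(1,2) s] rank]] this]
      have "q i $ k - p i $ k = 0" using i by blast
      then show ?thesis by simp
    qed
    then have "q i = p i" if "i < n" for i using that qc[OF that] p[OF that] by auto
    with ab show False by simp
  qed
  show ?thesis unfolding conn stress using 12 21 23 34 41 by blast
qed

end
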